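(* Let $A$ be a finite alphabet, let $f : A^{\mathbb{Z}} \to A^{\mathbb{Z}}$ be a cellular automaton, and suppose that the restriction of $f$ to its generic limit set $\tilde\omega(f)$ is eventually oblique. Then the language $\mathcal{L}(\tilde\omega(f))$ is $\Pi^0_2$.
   Context: $\mathbb{N}$ contains $0$. For a finite alphabet $A$, the full shift $A^{\mathbb{Z}}$ has the product topology (a compact metrizable space), and the left shift $\sigma$ is given by $\sigma(x)_i = x_{i+1}$. A cellular automaton (CA) on a closed $\sigma$-invariant set (subshift) $X \subset A^{\mathbb{Z}}$ is a continuous map $f : X \to X$ commuting with $\sigma$. A subset of a topological space is comeager if it contains an intersection of countably many dense open sets. For a CA $f$ on $A^{\mathbb{Z}}$ and $x \in A^{\mathbb{Z}}$, $\omega(x)$ is the set of limit points (limits of subsequences) of the forward orbit $(f^t(x))_{t\in\mathbb{N}}$. For $Y \subset A^{\mathbb{Z}}$, the realm of attraction is $\mathfrak{D}(Y) = \{x \in A^{\mathbb{Z}} \mid \omega(x) \subset Y\}$. The generic limit set $\tilde\omega(f)$ is the intersection of all closed sets $C \subset A^{\mathbb{Z}}$ such that $\mathfrak{D}(C)$ is comeager. It is a nonempty $f$-invariant subshift and has a comeager realm. A neighborhood of a CA $g : X \to X$ on a subshift $X$ is a finite set $N \subset \mathbb{Z}$ such that for all $x \in X$ and $i \in \mathbb{Z}$ the symbol $g(x)_i$ is determined by the restriction of $x$ to $i + N$ (by the same rule for each $i$). A CA $f : X \to X$ on a subshift $X$ is eventually oblique if for some (equivalently, all large enough) $n \in \mathbb{N}$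 the map $f^n$ has a neighborhood that is contained in $(-\infty,-1]$ or in $[1,\infty)$. For $w \in A^*$, $[w] = \{x \in A^{\mathbb{Z}} \mid x_{[0,|w|)} = w\}$. The language of a subshift $X$ is $\mathcal{L}(X) = \{w \in A^* \mid [w] \cap X \neq \emptyset\}$. $\Sigma^0_n$, $\Pi^0_n$ refer to the arithmetical hierarchy of subsets of $\mathbb{N}$, extended to subsets of sets in computable bijection with $\mathbb{N}$ (such as $A^*$). *)

theory Defs
  imports "HOL-Analysis.Analysis"
begin

section \<open>Cellular automata on subshifts\<close>

text \<open>
  The alphabet is the whole of a finite type \<open>'a\<close>. The full shift carries the product of the
  discrete topologies as an explicit topology, so that no topological type class is
  imposed on \<open>'a\<close>; its topspace is \<open>UNIV\<close>.
\<close>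

definition full_shift :: "(int \<Rightarrow> 'a::finite) topology" where
  "full_shift = product_topology (\<lambda>_. discrete_topology UNIV) UNIV"

lemma topspace_full_shift [simp]: "topspace full_shift = UNIV"
  by (simp add: full_shift_def)

definition shift :: "(int \<Rightarrow> 'a) \<Rightarrow> (int \<Rightarrow> 'a)" where
  "shift x = (\<lambda>i. x (i + 1))"

definition subshift :: "(int \<Rightarrow> 'a::finite) set \<Rightarrow> bool" where
  "subshift X \<longleftrightarrow> closedin full_shift X \<and> shift ` X = X"

definition cellular_automaton ::
    "(int \<Rightarrow> 'a::finite) set \<Rightarrow> ((int \<Rightarrow> 'a) \<Rightarrow> (int \<Rightarrow> 'a)) \<Rightarrow> bool" where
  "cellular_automaton X g \<longleftrightarrow>
     subshift X \<and>
     continuous_map (subtopology full_shift X) (subtopology full_shift X) g \<and>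
     (\<forall>x\<in>X. g (shift x) = shift (g x))"

text \<open>
  \<open>F\<close> is the common local rule. It only sees \<open>x\<close> on \<open>i + N\<close>, since \<open>restrict\<close> forgets the
  values outside \<open>N\<close>.
\<close>

definition ca_neighborhood ::
    "(int \<Rightarrow> 'a) set \<Rightarrow> ((int \<Rightarrow> 'a) \<Rightarrow> (int \<Rightarrow> 'a)) \<Rightarrow> int set \<Rightarrow> bool" where
  "ca_neighborhood X g N \<longleftrightarrow>
     finite N \<and> (\<exists>F. \<forall>x\<in>X. \<forall>i. g x i = F (restrict (\<lambda>j. x (i + j)) N))"

text \<open>
  For \<open>f\<close> mapping \<open>X\<close> into itself, the powers of \<open>f\<close> agree on \<open>X\<close> with those of the restriction
  of \<open>f\<close> to \<open>X\<close>, and \<open>ca_neighborhood X\<close> depends only on the values on \<open>X\<close>.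
\<close>

definition eventually_oblique ::
    "(int \<Rightarrow> 'a) set \<Rightarrow> ((int \<Rightarrow> 'a) \<Rightarrow> (int \<Rightarrow> 'a)) \<Rightarrow> bool" where
  "eventually_oblique X f \<longleftrightarrow>
     (\<exists>n::nat. \<exists>N. ca_neighborhood X (f ^^ n) N \<and> (N \<subseteq> {..-1} \<or> N \<subseteq> {1..}))"

section \<open>Generic limit sets\<close>

definition comeager :: "'b topology \<Rightarrow> 'b set \<Rightarrow> bool" where
  "comeager T S \<longleftrightarrow>
     S \<subseteq> topspace T \<and>
     (\<exists>\<U>. countable \<U> \<and>
          (\<forall>U\<in>\<U>. openin T U \<and> T closure_of U = topspace T) \<and>
          topspace T \<inter> \<Inter>\<U> \<subseteq> S)"

definition omega_limit ::
    "((int \<Rightarrow> 'a::finite) \<Rightarrow> (int \<Rightarrow> 'a)) \<Rightarrow> (int \<Rightarrow> 'a) \<Rightarrow> (int \<Rightarrow> 'a) set" where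
  "omega_limit f x =
     {y. \<exists>r. strict_mono (r :: nat \<Rightarrow> nat) \<and>
             limitin full_shift (\<lambda>n. (f ^^ r n) x) y sequentially}"

definition realm ::
    "((int \<Rightarrow> 'a::finite) \<Rightarrow> (int \<Rightarrow> 'a)) \<Rightarrow> (int \<Rightarrow> 'a) set \<Rightarrow> (int \<Rightarrow> 'a) set" where
  "realm f Y = {x. omega_limit f x \<subseteq> Y}"

definition generic_limit_set ::
    "((int \<Rightarrow> 'a::finite) \<Rightarrow> (int \<Rightarrow> 'a)) \<Rightarrow> (int \<Rightarrow> 'a) set" where
  "generic_limit_set f = \<Inter>{C. closedin full_shift C \<and> comeager full_shift (realm f C)}"

section \<open>Languages\<close>

definition cylinder :: "'a list \<Rightarrow> (int \<Rightarrow> 'a) set" where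
  "cylinder w = {x. \<forall>i<length w. x (int i) = w ! i}"

definition language :: "(int \<Rightarrow> 'a) set \<Rightarrow> 'a list set" where
  "language X = {w. cylinder w \<inter> X \<noteq> {}}"

section \<open>Recursive functions and the arithmetical hierarchy\<close>

text \<open>
  \<open>total_recursive k f\<close>: on argument lists of length \<open>k\<close>, \<open>f\<close> is a total recursive function of
  \<open>k\<close> variables. These are generated from the basic functions by composition, primitive
  recursion and minimization of regular functions (those for which a zero always exists), so no
  partial functions are needed. The last rule makes the values of \<open>f\<close> on lists of
  other lengths irrelevant.
\<close>

inductive total_recursive :: "nat \<Rightarrow> (nat list \<Rightarrow> nat) \<Rightarrow> bool" where
  rec_zero: "total_recursive k (\<lambda>_. 0)"
| rec_Suc: "total_recursive 1 (\<lambda>xs. Suc (xs ! 0))"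
| rec_proj: "i < k \<Longrightarrow> total_recursive k (\<lambda>xs. xs ! i)"
| rec_comp: "total_recursive (length gs) f \<Longrightarrow> (\<forall>g\<in>set gs. total_recursive k g) \<Longrightarrow>
    total_recursive k (\<lambda>xs. f (map (\<lambda>g. g xs) gs))"
| rec_primrec: "total_recursive k f \<Longrightarrow> total_recursive (Suc (Suc k)) g \<Longrightarrow>
    total_recursive (Suc k)
      (\<lambda>xs. rec_nat (f (tl xs)) (\<lambda>n r. g (n # r # tl xs)) (hd xs))"
| rec_mu: "total_recursive (Suc k) f \<Longrightarrow> (\<forall>xs. length xs = k \<longrightarrow> (\<exists>y. f (y # xs) = 0)) \<Longrightarrow>
    total_recursive k (\<lambda>xs. LEAST y. f (y # xs) = 0)"
| rec_ext: "total_recursive k f \<Longrightarrow> (\<forall>xs. length xs = k \<longrightarrow> g xs = f xs) \<Longrightarrow>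
    total_recursive k g"

definition decidable_rel :: "nat \<Rightarrow> (nat list \<Rightarrow> bool) \<Rightarrow> bool" where
  "decidable_rel k P \<longleftrightarrow> total_recursive k (\<lambda>xs. if P xs then 1 else 0)"

text \<open>\<open>is_Sigma n k P\<close> and \<open>is_Pi n k P\<close>: the \<open>k\<close>-ary relation \<open>P\<close> on the naturals is
  \<open>\<Sigma>\<^sup>0\<^sub>n\<close>, respectively \<open>\<Pi>\<^sup>0\<^sub>n\<close>.\<close>

fun is_Sigma :: "nat \<Rightarrow> nat \<Rightarrow> (nat list \<Rightarrow> bool) \<Rightarrow> bool"
  and is_Pi :: "nat \<Rightarrow> nat \<Rightarrow> (nat list \<Rightarrow> bool) \<Rightarrow> bool" where
  "is_Sigma 0 k P \<longleftrightarrow> decidable_rel k P"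
| "is_Sigma (Suc n) k P \<longleftrightarrow>
     (\<exists>Q. is_Pi n (Suc k) Q \<and> (\<forall>xs. length xs = k \<longrightarrow> (P xs \<longleftrightarrow> (\<exists>y. Q (y # xs)))))"
| "is_Pi 0 k P \<longleftrightarrow> decidable_rel k P"
| "is_Pi (Suc n) k P \<longleftrightarrow>
     (\<exists>Q. is_Sigma n (Suc k) Q \<and> (\<forall>xs. length xs = k \<longrightarrow> (P xs \<longleftrightarrow> (\<forall>y. Q (y # xs)))))"

definition Pi0 :: "nat \<Rightarrow> nat set \<Rightarrow> bool" where
  "Pi0 n S \<longleftrightarrow> is_Pi n 1 (\<lambda>xs. xs ! 0 \<in> S)"

text \<open>
  Words are identified with naturals by bijective base-\<open>CARD('a)\<close> numeration, given a numbering
  \<open>e\<close> of the letters by \<open>0, \<dots>, CARD('a) - 1\<close>.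
\<close>

fun word_code :: "('a::finite \<Rightarrow> nat) \<Rightarrow> 'a list \<Rightarrow> nat" where
  "word_code e [] = 0"
| "word_code e (a # w) = Suc (e a + CARD('a) * word_code e w)"

lemma bij_word_code:
  fixes e :: "'a::finite \<Rightarrow> nat"
  assumes e: "bij_betw e UNIV {..<CARD('a)}"
  shows "bij (word_code e)"
proof (rule bijI)
  have lt: "e a < CARD('a)" for a
    using e by (auto simp: bij_betw_def)
  have inj_e: "inj e"
    using e by (simp add: bij_betw_def)
  show "inj (word_code e)"
  proof (rule injI)
    fix v w :: "'a list"
    assume "word_code e v = word_code e w"
    then show "v = w"
    proof (induction v arbitrary: w)
      case Nil
      then show ?case by (cases w) auto
    next
      case (Cons a v)
      then obtain b u where w: "w = b # u"
        by (cases w) auto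
      with Cons.prems have eq: "e a + CARD('a) * word_code e v = e b + CARD('a) * word_code e u"
        by simp
      have "e a = e b"
        using arg_cong[OF eq, of "\<lambda>n. n mod CARD('a)"] lt by simp
      moreover have "word_code e v = word_code e u"
        using eq calculation by simp
      ultimately show ?case
        using Cons.IH w inj_e by (simp add: inj_eq)
    qed
  qed
  have "\<exists>w. word_code e w = n" for n
  proof (induction n rule: less_induct)
    case (less n)
    show ?case
    proof (cases n)
      case 0
      then show ?thesis by (metis word_code.simps(1))
    next
      case (Suc m)
      have "m div CARD('a) < n"
        using Suc div_le_dividend le_imp_less_Suc by blast
      then obtain w where w: "word_code e w = m div CARD('a)"
        using less by blast
      have "m mod CARD('a) \<in> e ` UNIV"
        using e by (simp add: bij_betw_def)
      then obtain a where "e a = m mod CARD('a)"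
        by (metis imageE)
      then have "word_code e (a # w) = n"
        using w Suc by simp
      then show ?thesis by blast
    qed
  qed
  then show "surj (word_code e)"
    by (metis surjI)
qed

definition Pi0_words :: "nat \<Rightarrow> 'a::finite list set \<Rightarrow> bool" where
  "Pi0_words n L \<longleftrightarrow>
     (\<forall>e. bij_betw e UNIV {..<CARD('a)} \<longrightarrow> Pi0 n (word_code e ` L))"

end

theory Submission
  imports Defs
begin

text \<open>
  Let \<open>X\<close> be the generic limit set. By the Baire category theorem every cylinder contains a
  cylinder whose orbits eventually look like points of \<open>X\<close> on a given interval, and there \<open>f ^^ n\<close>
  passes information in one direction only, say to the left. Hence there is a word \<open>v\<close> to the right
  of which the evolution does not depend on what is to the left of it. Given two cylinders,
  place \<open>v\<close> far to the right of both and let the stretch up to \<open>v\<close> settle in both cases: the same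
  information arrives from \<open>v\<close>, so some points of the two cylinders have eventually equal orbits on
  any fixed interval. Thus a word that recurs on the orbits of one cylinder recurs on those of all,
  and \<open>w\<close> is in the language of \<open>X\<close> iff for every cylinder \<open>U\<close> and every \<open>T\<close> there is
  \<open>t \<ge> T\<close> such that \<open>f ^^ t\<close> maps a point of \<open>U\<close> into the cylinder of \<open>w\<close>. This is a \<open>\<Pi>\<^sup>0\<^sub>2\<close>
  condition, since the existence of such a point is decidable.
\<close>

section \<open>Dynamics of oblique regions\<close>

definition translate :: "int \<Rightarrow> (int \<Rightarrow> 'a) \<Rightarrow> (int \<Rightarrow> 'a)" where
  "translate k x = (\<lambda>i. x (i + k))"

text \<open>Every nonempty open set contains a central window, so these stand for arbitrary open
  sets. A negative \<open>m\<close> constrains nothing and gives the whole space.\<close>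

definition window :: "(int \<Rightarrow> 'a) \<Rightarrow> int \<Rightarrow> (int \<Rightarrow> 'a) set" where
  "window p m = {x. \<forall>i. \<bar>i\<bar> \<le> m \<longrightarrow> x i = p i}"

definition has_radius :: "int \<Rightarrow> ((int \<Rightarrow> 'a) \<Rightarrow> (int \<Rightarrow> 'a)) \<Rightarrow> bool" where
  "has_radius R f \<longleftrightarrow> (\<forall>x y i. (\<forall>j. \<bar>j - i\<bar> \<le> R \<longrightarrow> x j = y j) \<longrightarrow> f x i = f y i)"

lemma has_radiusD:
  "has_radius R f \<Longrightarrow> (\<And>j. \<bar>j - i\<bar> \<le> R \<Longrightarrow> x j = y j) \<Longrightarrow> f x i = f y i"
  unfolding has_radius_def by blast

lemma translate_apply [simp]: "translate k x i = x (i + k)"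
  by (simp add: translate_def)

lemma translate_0 [simp]: "translate 0 x = x"
  by (simp add: translate_def)

lemma translate_translate [simp]: "translate k (translate l x) = translate (k + l) x"
  by (simp add: translate_def add.assoc)

lemma shift_eq_translate: "shift = translate 1"
  by (auto simp: shift_def translate_def)

lemma window_refl [simp]: "p \<in> window p m"
  by (simp add: window_def)

lemma window_mono: "m \<le> m' \<Longrightarrow> window p m' \<subseteq> window p m"
  by (auto simp: window_def)

lemma commute_translate:
  fixes f :: "(int \<Rightarrow> 'a) \<Rightarrow> (int \<Rightarrow> 'a)"
  assumes "\<And>x. f (shift x) = shift (f x)"
  shows "f (translate k x) = translate k (f x)"
proof (induction k rule: int_induct[where k = 0])
  case base
  then show ?case by simp
next
  case (step1 k)
  have "translate (k + 1) x = shift (translate k x)" for x :: "int \<Rightarrow> 'a"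
    by (simp add: shift_eq_translate add.commute)
  then show ?case using step1 assms
    by metis
next
  case (step2 k)
  have "f (translate k x) = f (shift (translate (k - 1) x))"
    by (simp add: shift_eq_translate)
  then have "translate k (f x) = translate 1 (f (translate (k - 1) x))"
    using step2(2) assms by (metis shift_eq_translate)
  then have "translate (-1) (translate k (f x)) = translate (-1) (translate 1 (f (translate (k - 1) x)))"
    by simp
  then show ?case by (simp del: translate_apply)
qed

lemma funpow_commute_translate:
  fixes f :: "(int \<Rightarrow> 'a) \<Rightarrow> (int \<Rightarrow> 'a)"
  assumes "\<And>k x. f (translate k x) = translate k (f x)"
  shows "(f ^^ t) (translate k x) = translate k ((f ^^ t) x)"
  by (induction t) (simp_all add: assms del: translate_apply)

lemma has_radius_funpow:
  fixes f :: "(int \<Rightarrow> 'a) \<Rightarrow> (int \<Rightarrow> 'a)"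
  assumes "has_radius R f" "0 \<le> R"
  shows "has_radius (int n * R) (f ^^ n)"
proof (induction n)
  case 0
  then show ?case by (simp add: has_radius_def)
next
  case (Suc n)
  show ?case unfolding has_radius_def
  proof (intro allI impI)
    fix x y :: "int \<Rightarrow> 'a" and i
    assume eq: "\<forall>j. \<bar>j - i\<bar> \<le> int (Suc n) * R \<longrightarrow> x j = y j"
    have "f ((f ^^ n) x) i = f ((f ^^ n) y) i"
    proof (rule has_radiusD[OF assms(1)])
      fix j assume j: "\<bar>j - i\<bar> \<le> R"
      show "(f ^^ n) x j = (f ^^ n) y j"
      proof (rule has_radiusD[OF Suc])
        fix l assume "\<bar>l - j\<bar> \<le> int n * R"
        then have "\<bar>l - i\<bar> \<le> int (Suc n) * R" using j by (simp add: algebra_simps)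
        then show "x l = y l" using eq by blast
      qed
    qed
    then show "(f ^^ Suc n) x i = (f ^^ Suc n) y i" by simp
  qed
qed

text \<open>\<open>G\<close> will mean that a point looks like the generic limit set near the
  origin. Keeping only that orbits settle in \<open>G\<close> on some subwindow of every window, and
  that inside \<open>G\<close> the map \<open>f ^^ n\<close> looks strictly to the right, makes the
  argument reusable for the mirror image.\<close>

locale settling_oblique =
  fixes f :: "(int \<Rightarrow> 'a) \<Rightarrow> (int \<Rightarrow> 'a)" and R :: int and n :: nat and G :: "(int \<Rightarrow> 'a) \<Rightarrow> bool"
  assumes commute: "f (translate k x) = translate k (f x)"
    and radius: "has_radius R f" and R_nonneg: "0 \<le> R" and n_pos: "0 < n"
    and settle: "\<exists>p' m' T. window p' m' \<subseteq> window p m \<and>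
                   (\<forall>x\<in>window p' m'. \<forall>t\<ge>T. G ((f ^^ t) x))"
    and oblique: "G x \<Longrightarrow> G y \<Longrightarrow> (\<And>j. 0 < j \<Longrightarrow> x j = y j) \<Longrightarrow> (f ^^ n) x 0 = (f ^^ n) y 0"
begin

lemmas funpow_commute = funpow_commute_translate[of f, OF commute]

lemma oblique_at:
  assumes "G (translate i x)" "G (translate i y)" "\<And>j. i < j \<Longrightarrow> x j = y j"
  shows "(f ^^ n) x i = (f ^^ n) y i"
proof -
  have "(f ^^ n) (translate i x) 0 = (f ^^ n) (translate i y) 0"
    using assms by (intro oblique) auto
  then show ?thesis by (simp add: funpow_commute)
qed

text \<open>Apply \<open>settle\<close> to the translated pattern and translate back. Radii grow by
  \<open>\<bar>i\<bar>\<close> because a translate of a central window is not central.\<close>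

lemma settle_at:
  "\<exists>p' m' T. window p' m' \<subseteq> window p m \<and>
     (\<forall>x\<in>window p' m'. \<forall>t\<ge>T. G (translate i ((f ^^ t) x)))"
proof -
  obtain p' m' T where *: "window p' m' \<subseteq> window (translate i p) (m + \<bar>i\<bar>)"
    "\<forall>x\<in>window p' m'. \<forall>t\<ge>T. G ((f ^^ t) x)"
    using settle by blast
  have sub: "translate i x \<in> window p' m'" if "x \<in> window (translate (-i) p') (m' + \<bar>i\<bar>)" for x
    using that by (auto simp: window_def)
  have "window (translate (-i) p') (m' + \<bar>i\<bar>) \<subseteq> window p m"
  proof
    fix x assume "x \<in> window (translate (-i) p') (m' + \<bar>i\<bar>)"
    then have "translate i x \<in> window (translate i p) (m + \<bar>i\<bar>)"
      using sub *(1) by blast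
    then have eq: "x (j + i) = p (j + i)" if "\<bar>j\<bar> \<le> m + \<bar>i\<bar>" for j
      using that by (auto simp: window_def)
    have "x j = p j" if "\<bar>j\<bar> \<le> m" for j
      using eq[of "j - i"] that by simp
    then show "x \<in> window p m" by (simp add: window_def)
  qed
  moreover have "\<forall>x\<in>window (translate (-i) p') (m' + \<bar>i\<bar>). \<forall>t\<ge>T. G (translate i ((f ^^ t) x))"
    using sub *(2) by (simp add: funpow_commute[symmetric] del: translate_apply)
  ultimately show ?thesis by blast
qed

lemma settle_on:
  assumes "finite I"
  shows "\<exists>p' m' T. window p' m' \<subseteq> window p m \<and>
     (\<forall>x\<in>window p' m'. \<forall>t\<ge>T. \<forall>i\<in>I. G (translate i ((f ^^ t) x)))"
  using assms
proof (induction I)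
  case empty
  then show ?case by auto
next
  case (insert i I)
  then obtain p1 m1 T1 where 1: "window p1 m1 \<subseteq> window p m"
     "\<forall>x\<in>window p1 m1. \<forall>t\<ge>T1. \<forall>i\<in>I. G (translate i ((f ^^ t) x))"
    by blast
  obtain p2 m2 T2 where 2: "window p2 m2 \<subseteq> window p1 m1"
     "\<forall>x\<in>window p2 m2. \<forall>t\<ge>T2. G (translate i ((f ^^ t) x))"
    using settle_at by blast
  have "window p2 m2 \<subseteq> window p m" using 1(1) 2(1) by blast
  moreover have "\<forall>x\<in>window p2 m2. \<forall>t\<ge>max T1 T2. \<forall>i\<in>insert i I. G (translate i ((f ^^ t) x))"
    using 1(2) 2 by auto
  ultimately show ?case by blast
qed

text \<open>Near the origin only \<open>oblique\<close> is available to exclude information from the left; further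
  to the right the radius alone does so.\<close>

lemma blocking_word:
  obtains v m T where "0 \<le> m"
    and "\<And>x y t i. \<lbrakk>x \<in> window v m; y \<in> window v m; \<And>j. - m \<le> j \<Longrightarrow> x j = y j; T \<le> t; 0 \<le> i\<rbrakk>
           \<Longrightarrow> (f ^^ t) x i = (f ^^ t) y i"
proof -
  define Rn where "Rn = int n * R"
  have Rn: "has_radius Rn (f ^^ n)"
    unfolding Rn_def by (rule has_radius_funpow[OF radius R_nonneg])
  \<comment> \<open>Settling on \<open>{0..Rn}\<close> suffices: within \<open>n\<close> steps a
    cell beyond \<open>Rn\<close> sees only positive cells.\<close>
  obtain v m' T where *:
    "\<forall>x\<in>window v m'. \<forall>t\<ge>T. \<forall>i\<in>{0..Rn}. G (translate i ((f ^^ t) x))"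
    using settle_on[of "{0..Rn}"] by blast
  \<comment> \<open>The margin handles times below \<open>T + n\<close>, from which the induction
    cannot go back \<open>n\<close> steps to a settled time: information then travels at most
    \<open>m\<close> cells.\<close>
  define m where "m = max m' (int (T + n) * R)"
  have m_ge: "int (T + n) * R \<le> m" "m' \<le> m" by (simp_all add: m_def)
  have *: "\<forall>x\<in>window v m. \<forall>t\<ge>T. \<forall>i\<in>{0..Rn}. G (translate i ((f ^^ t) x))"
    using * window_mono[OF m_ge(2)] by blast
  have "(f ^^ t) x i = (f ^^ t) y i"
    if xy: "x \<in> window v m" "y \<in> window v m" "\<And>j. - m \<le> j \<Longrightarrow> x j = y j" and "T \<le> t" "0 \<le> i"
    for x y t i
    using \<open>T \<le> t\<close> \<open>0 \<le> i\<close>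
  proof (induction t arbitrary: i rule: less_induct)
    case (less t)
    show ?case
    proof (cases "t < T + n")
      case True
      have "int t * R \<le> int (T + n) * R"
        using True R_nonneg by (intro mult_right_mono) auto
      with m_ge have "int t * R \<le> m" by simp
      then show ?thesis
        using less.prems by (intro has_radiusD[OF has_radius_funpow[OF radius R_nonneg]] xy(3)) auto
    next
      case False
      define s where "s = t - n"
      have t: "t = n + s" and s: "s < t" "T \<le> s"
        using False n_pos by (auto simp: s_def)
      have IH: "(f ^^ s) x j = (f ^^ s) y j" if "0 \<le> j" for j
        using less.IH s that by blast
      have "(f ^^ n) ((f ^^ s) x) i = (f ^^ n) ((f ^^ s) y) i"
      proof (cases "i \<le> Rn")
        case True
        then show ?thesis
          using * xy s less.prems by (intro oblique_at IH) auto
      next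
        case False
        then show ?thesis by (intro has_radiusD[OF Rn] IH) auto
      qed
      then show ?thesis by (simp add: t funpow_add)
    qed
  qed
  moreover have "0 \<le> m"
    using m_ge(1) R_nonneg by (meson mult_nonneg_nonneg of_nat_0_le_iff order_trans)
  ultimately show ?thesis using that by blast
qed

text \<open>The partner \<open>y\<close> copies \<open>x\<close> from a blocking word around
  \<open>M\<close> onwards, so the orbits eventually agree to the right of \<open>M\<close>. On the
  settled stretch every further \<open>n\<close> steps extend the agreement by one cell to the left,
  until \<open>[-k, k]\<close> is covered.\<close>

lemma shadowing:
  "\<exists>p' m' T. window p' m' \<subseteq> window q l \<and>
     (\<forall>x\<in>window p' m'. \<exists>y\<in>window p m. \<forall>t\<ge>T. \<forall>i. \<bar>i\<bar> \<le> k \<longrightarrow> (f ^^ t) x i = (f ^^ t) y i)"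
proof -
  obtain v m0 T0 where m0: "0 \<le> m0" and block:
    "\<And>x y t i. \<lbrakk>x \<in> window v m0; y \<in> window v m0; \<And>j. - m0 \<le> j \<Longrightarrow> x j = y j; T0 \<le> t; 0 \<le> i\<rbrakk>
           \<Longrightarrow> (f ^^ t) x i = (f ^^ t) y i"
    by (rule blocking_word) blast
  \<comment> \<open>The word \<open>v\<close>, centred at \<open>M\<close> and starting at
    \<open>c\<close>, must lie to the right of both given windows and of
    \<open>[-k, k]\<close>.\<close>
  define M where "M = m0 + \<bar>m\<bar> + \<bar>l\<bar> + \<bar>k\<bar> + 1"
  define c where "c = M - m0"
  have c: "m < c" "l < c" "c = M - m0" "k < M" "0 < M"
    using m0 by (auto simp: M_def c_def)
  define a where "a = (\<lambda>j. if j < c then p j else v (j - M))"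
  obtain a1 m1 T1 where a1: "window a1 m1 \<subseteq> window a (M + m0)"
    "\<forall>x\<in>window a1 m1. \<forall>t\<ge>T1. \<forall>i\<in>{-\<bar>k\<bar>..M}. G (translate i ((f ^^ t) x))"
    using settle_on[where I = "{-\<bar>k\<bar>..M}" and p = a and m = "M + m0"] by auto
  \<comment> \<open>Only the cells left of \<open>c\<close> are exchanged for \<open>q\<close>. From
    \<open>c\<close> on, \<open>b\<close> keeps what settling the first pattern prescribed, so that
    points near \<open>b\<close> can be completed to points of \<open>window a1 m1\<close>.\<close>
  define b where "b = (\<lambda>j. if j < c then q j else a1 j)"
  obtain b1 m2 T2 where b1: "window b1 m2 \<subseteq> window b (M + m0 + \<bar>m1\<bar>)"
    "\<forall>x\<in>window b1 m2. \<forall>t\<ge>T2. \<forall>i\<in>{-\<bar>k\<bar>..M}. G (translate i ((f ^^ t) x))"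
    using settle_on[where I = "{-\<bar>k\<bar>..M}" and p = b and m = "M + m0 + \<bar>m1\<bar>"] by auto
  define T where "T = T0 + T1 + T2"
  have b1_b: "x j = b j" if "x \<in> window b1 m2" "\<bar>j\<bar> \<le> M + m0 + \<bar>m1\<bar>" for x j
    using that b1(1) by (auto simp: window_def)
  have sub_q: "window b1 m2 \<subseteq> window q l"
  proof
    fix x assume x: "x \<in> window b1 m2"
    have "x j = q j" if "\<bar>j\<bar> \<le> l" for j
    proof -
      have "\<bar>j\<bar> \<le> M + m0 + \<bar>m1\<bar>" "j < c" using that c m0 by linarith+
      then show ?thesis using b1_b[OF x] by (simp add: b_def)
    qed
    then show "x \<in> window q l" by (simp add: window_def)
  qed
  have main: "\<exists>y\<in>window p m. \<forall>t\<ge>T + n * nat (M + \<bar>k\<bar>). \<forall>i. \<bar>i\<bar> \<le> k \<longrightarrow> (f ^^ t) x i = (f ^^ t) y i"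
    if x: "x \<in> window b1 m2" for x
  proof
    define y where "y = (\<lambda>j. if j < c then a1 j else x j)"
    have "y j = a1 j" if "\<bar>j\<bar> \<le> m1" for j
    proof -
      have "\<bar>j\<bar> \<le> M + m0 + \<bar>m1\<bar>" using that c m0 by linarith
      then show ?thesis using b1_b[OF x] by (simp add: y_def b_def)
    qed
    then have y: "y \<in> window a1 m1"
      by (simp add: window_def)
    then have y_a: "y j = a j" if "\<bar>j\<bar> \<le> M + m0" for j
      using a1(1) that by (auto simp: window_def)
    have "y j = p j" if "\<bar>j\<bar> \<le> m" for j
    proof -
      have "\<bar>j\<bar> \<le> M + m0" "j < c" using that c m0 by linarith+
      then show ?thesis using y_a by (simp add: a_def)
    qed
    then show "y \<in> window p m"
      by (simp add: window_def)
    have yv: "y (j + M) = v j" if "\<bar>j\<bar> \<le> m0" for j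
    proof -
      have "\<bar>j + M\<bar> \<le> M + m0" "\<not> j + M < c" using that c m0 by linarith+
      then show ?thesis using y_a by (simp add: a_def)
    qed
    then have ty: "translate M y \<in> window v m0"
      by (simp add: window_def)
    have "x (j + M) = v j" if "\<bar>j\<bar> \<le> m0" for j
    proof -
      have "\<not> j + M < c" using that c m0 by linarith
      then show ?thesis using yv[OF that] by (simp add: y_def)
    qed
    then have tx: "translate M x \<in> window v m0"
      by (simp add: window_def)
    have right: "(f ^^ t) x i = (f ^^ t) y i" if "T \<le> t" "M \<le> i" for t i
    proof -
      have "(f ^^ t) (translate M x) (i - M) = (f ^^ t) (translate M y) (i - M)"
        using that by (intro block[OF tx ty]) (auto simp: y_def c(3) T_def)
      then show ?thesis by (simp add: funpow_commute)
    qed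
    \<comment> \<open>From time \<open>T + n * d\<close> on the orbits agree from
      \<open>M - d\<close> to the right. The bound on \<open>d\<close> keeps this front inside the
      interval on which both orbits satisfy \<open>G\<close>.\<close>
    have "(f ^^ t) x i = (f ^^ t) y i"
      if "T + n * d \<le> t" "d \<le> nat (M + \<bar>k\<bar>)" "M - int d \<le> i" for t i d
      using that
    proof (induction d arbitrary: t i)
      case 0
      then show ?case using right by simp
    next
      case (Suc d)
      show ?case
      proof (cases "i = M - int (Suc d)")
        case True
        define s where "s = t - n"
        have t: "t = n + s" and s: "T + n * d \<le> s" "T1 \<le> s" "T2 \<le> s"
          using Suc.prems by (auto simp: s_def T_def)
        have i: "i \<in> {-\<bar>k\<bar>..M}"
          using True Suc.prems by auto
        have "(f ^^ n) ((f ^^ s) x) i = (f ^^ n) ((f ^^ s) y) i"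
        proof (rule oblique_at)
          show "G (translate i ((f ^^ s) x))" using b1(2) x s i by blast
          show "G (translate i ((f ^^ s) y))" using a1(2) y s i by blast
          show "(f ^^ s) x j = (f ^^ s) y j" if "i < j" for j
            using that True Suc.prems(2) s by (intro Suc.IH) auto
        qed
        then show ?thesis by (simp add: t funpow_add)
      next
        case False
        then show ?thesis using Suc.prems by (intro Suc.IH) auto
      qed
    qed
    from this[of "nat (M + \<bar>k\<bar>)"]
    show "\<forall>t\<ge>T + n * nat (M + \<bar>k\<bar>). \<forall>i. \<bar>i\<bar> \<le> k \<longrightarrow> (f ^^ t) x i = (f ^^ t) y i"
      using c by auto
  qed
  show ?thesis using sub_q main by blast
qed

end

section \<open>Reflection, for neighborhoods on the left\<close>

definition reflect :: "(int \<Rightarrow> 'a) \<Rightarrow> (int \<Rightarrow> 'a)" where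
  "reflect x = (\<lambda>i. x (- i))"

lemma reflect_apply [simp]: "reflect x i = x (- i)"
  by (simp add: reflect_def)

lemma reflect_reflect [simp]: "reflect (reflect x) = x"
  by (simp add: reflect_def)

lemma reflect_mem_window_iff: "reflect x \<in> window p m \<longleftrightarrow> x \<in> window (reflect p) m"
proof -
  have "(\<forall>i. \<bar>i\<bar> \<le> m \<longrightarrow> x (- i) = p i) \<longleftrightarrow> (\<forall>i. \<bar>i\<bar> \<le> m \<longrightarrow> x i = p (- i))"
    by (metis abs_minus_cancel minus_minus)
  then show ?thesis by (simp add: window_def)
qed

lemma window_reflect_subset:
  assumes "window p' m' \<subseteq> window (reflect p) m"
  shows "window (reflect p') m' \<subseteq> window p m"
proof
  fix x assume "x \<in> window (reflect p') m'"
  then have "reflect x \<in> window (reflect p) m"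
    using assms reflect_mem_window_iff by blast
  then show "x \<in> window p m"
    using reflect_mem_window_iff[of x "reflect p"] by (simp del: reflect_apply)
qed

lemma funpow_conj_reflect:
  fixes f :: "(int \<Rightarrow> 'a) \<Rightarrow> (int \<Rightarrow> 'a)"
  shows "((\<lambda>x. reflect (f (reflect x))) ^^ t) x = reflect ((f ^^ t) (reflect x))"
  by (induction t) simp_all

text \<open>Conjugation with \<open>reflect\<close> exchanges the two directions and maps central
  windows to central windows, so \<open>shadowing\<close> applies to the conjugated map.\<close>

lemma shadowing_left:
  fixes f :: "(int \<Rightarrow> 'a) \<Rightarrow> (int \<Rightarrow> 'a)"
  assumes commute: "\<And>k x. f (translate k x) = translate k (f x)"
    and radius: "has_radius R f" and R_nonneg: "0 \<le> R" and n_pos: "0 < n"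
    and settle: "\<And>p m. \<exists>p' m' T. window p' m' \<subseteq> window p m \<and>
                   (\<forall>x\<in>window p' m'. \<forall>t\<ge>T. G ((f ^^ t) x))"
    and oblique: "\<And>x y. G x \<Longrightarrow> G y \<Longrightarrow> (\<And>j. j < 0 \<Longrightarrow> x j = y j) \<Longrightarrow> (f ^^ n) x 0 = (f ^^ n) y 0"
  shows "\<exists>p' m' T. window p' m' \<subseteq> window q l \<and>
     (\<forall>x\<in>window p' m'. \<exists>y\<in>window p m. \<forall>t\<ge>T. \<forall>i. \<bar>i\<bar> \<le> k \<longrightarrow> (f ^^ t) x i = (f ^^ t) y i)"
proof -
  have settle': "\<exists>p' m' T. window p' m' \<subseteq> window p m \<and>
        (\<forall>x\<in>window p' m'. \<forall>t\<ge>T. G ((f ^^ t) (reflect x)))" for p m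
  proof -
    obtain p' m' T where *: "window p' m' \<subseteq> window (reflect p) m"
      "\<forall>x\<in>window p' m'. \<forall>t\<ge>T. G ((f ^^ t) x)"
      using settle by blast
    then have "window (reflect p') m' \<subseteq> window p m"
      by (simp add: window_reflect_subset)
    moreover have "\<forall>x\<in>window (reflect p') m'. \<forall>t\<ge>T. G ((f ^^ t) (reflect x))"
      using *(2) by (simp add: reflect_mem_window_iff[symmetric])
    ultimately show ?thesis by blast
  qed
  interpret settling_oblique "\<lambda>x. reflect (f (reflect x))" R n "\<lambda>x. G (reflect x)"
  proof
    fix k x
    have "reflect (translate k x) = translate (-k) (reflect x)" for k and x :: "int \<Rightarrow> 'a"
      by (auto simp: reflect_def)
    then show "reflect (f (reflect (translate k x))) = translate k (reflect (f (reflect x)))"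
      by (simp add: commute)
  next
    show "has_radius R (\<lambda>x. reflect (f (reflect x)))"
      unfolding has_radius_def
    proof (intro allI impI)
      fix x y :: "int \<Rightarrow> 'a" and i
      assume *: "\<forall>j. \<bar>j - i\<bar> \<le> R \<longrightarrow> x j = y j"
      have "f (reflect x) (- i) = f (reflect y) (- i)"
        using * by (intro has_radiusD[OF radius]) auto
      then show "reflect (f (reflect x)) i = reflect (f (reflect y)) i" by simp
    qed
  next
    show "0 \<le> R" "0 < n" by fact+
  next
    show "\<exists>p' m' T. window p' m' \<subseteq> window p m \<and>
        (\<forall>x\<in>window p' m'. \<forall>t\<ge>T. G (reflect (((\<lambda>x. reflect (f (reflect x))) ^^ t) x)))" for p m
      using settle' by (simp add: funpow_conj_reflect)
  next
    fix x y :: "int \<Rightarrow> 'a"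
    assume "G (reflect x)" "G (reflect y)" "\<And>j. 0 < j \<Longrightarrow> x j = y j"
    then have "(f ^^ n) (reflect x) 0 = (f ^^ n) (reflect y) 0"
      by (intro oblique) auto
    then show "((\<lambda>x. reflect (f (reflect x))) ^^ n) x 0 = ((\<lambda>x. reflect (f (reflect x))) ^^ n) y 0"
      by (simp add: funpow_conj_reflect)
  qed
  obtain p' m' T where *: "window p' m' \<subseteq> window (reflect q) l"
    "\<forall>x\<in>window p' m'. \<exists>y\<in>window (reflect p) m. \<forall>t\<ge>T. \<forall>i. \<bar>i\<bar> \<le> k \<longrightarrow>
        (f ^^ t) (reflect x) (- i) = (f ^^ t) (reflect y) (- i)"
    using shadowing[of "reflect q" l "reflect p" m k] by (auto simp: funpow_conj_reflect)
  have "window (reflect p') m' \<subseteq> window q l"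
    using *(1) by (simp add: window_reflect_subset)
  moreover have "\<exists>y\<in>window p m. \<forall>t\<ge>T. \<forall>i. \<bar>i\<bar> \<le> k \<longrightarrow> (f ^^ t) x i = (f ^^ t) y i"
    if "x \<in> window (reflect p') m'" for x
  proof -
    have "reflect x \<in> window p' m'"
      using that by (simp add: reflect_mem_window_iff)
    then obtain y where y: "y \<in> window (reflect p) m"
      "\<forall>t\<ge>T. \<forall>i. \<bar>i\<bar> \<le> k \<longrightarrow> (f ^^ t) x (- i) = (f ^^ t) (reflect y) (- i)"
      using *(2) by fastforce
    have "(f ^^ t) x i = (f ^^ t) (reflect y) i" if "T \<le> t" "\<bar>i\<bar> \<le> k" for t i
      using y(2)[rule_format, of t "- i"] that by simp
    moreover have "reflect y \<in> window p m"
      using y(1) by (simp add: reflect_mem_window_iff)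
    ultimately show ?thesis by blast
  qed
  ultimately show ?thesis by blast
qed

section \<open>Topology and Baire category\<close>

lemma openin_full_shift_iff:
  "openin full_shift U \<longleftrightarrow> (\<forall>x\<in>U. \<exists>m. window x m \<subseteq> U)"
proof
  assume U: "openin full_shift U"
  show "\<forall>x\<in>U. \<exists>m. window x m \<subseteq> U"
  proof
    fix x assume "x \<in> U"
    then obtain V where V: "finite {i. V i \<noteq> UNIV}" "x \<in> Pi\<^sub>E UNIV V" "Pi\<^sub>E UNIV V \<subseteq> U"
      using U unfolding full_shift_def openin_product_topology_alt by auto
    \<comment> \<open>A basic open set of the product constrains finitely many cells, all contained
      in one central window.\<close>
    have "bdd_above (abs ` {i. V i \<noteq> UNIV})"
      using V(1) by (intro bdd_above_finite finite_imageI)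
    then obtain m where m: "\<And>i. V i \<noteq> UNIV \<Longrightarrow> \<bar>i\<bar> \<le> m"
      unfolding bdd_above_def by auto
    have "y i \<in> V i" if "y \<in> window x m" for y i
      using that m[of i] V(2) by (cases "V i = UNIV") (auto simp: window_def PiE_iff)
    then have "window x m \<subseteq> Pi\<^sub>E UNIV V"
      by (auto simp: PiE_iff)
    then show "\<exists>m. window x m \<subseteq> U" using V(3) by blast
  qed
next
  assume U: "\<forall>x\<in>U. \<exists>m. window x m \<subseteq> U"
  show "openin full_shift U"
    unfolding full_shift_def openin_product_topology_alt
  proof
    fix x assume "x \<in> U"
    then obtain m where m: "window x m \<subseteq> U" using U by blast
    define V where "V = (\<lambda>i. if \<bar>i\<bar> \<le> m then {x i} else UNIV)"
    have "{i. V i \<noteq> UNIV} \<subseteq> {-m..m}" by (auto simp: V_def)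
    then have "finite {i. V i \<noteq> UNIV}" using finite_subset by blast
    moreover have "Pi\<^sub>E UNIV V \<subseteq> window x m"
      by (auto simp: V_def window_def PiE_iff split: if_splits)
    moreover have "x \<in> Pi\<^sub>E UNIV V" by (auto simp: V_def PiE_iff)
    ultimately show "\<exists>V. finite {i \<in> UNIV. V i \<noteq> topspace (discrete_topology UNIV)} \<and>
        (\<forall>i\<in>UNIV. openin (discrete_topology UNIV) (V i)) \<and> x \<in> Pi\<^sub>E UNIV V \<and> Pi\<^sub>E UNIV V \<subseteq> U"
      using m by (intro exI[of _ V]) auto
  qed
qed

lemma clopen_if_window_determined:
  assumes "\<And>x y. y \<in> window x m \<Longrightarrow> x \<in> V \<longleftrightarrow> y \<in> V"
  shows "openin full_shift V" "closedin full_shift V"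
  unfolding closedin_def using assms by (auto simp: openin_full_shift_iff)

lemma openin_window: "openin full_shift (window p m)"
  and closedin_window: "closedin full_shift (window p m)"
  by (rule clopen_if_window_determined[of m]; auto simp: window_def)+

lemma window_nonempty: "window p m \<noteq> {}"
  by (metis empty_iff window_refl)

lemma dense_full_shift_iff:
  "full_shift closure_of U = UNIV \<longleftrightarrow> (\<forall>p m. window p m \<inter> U \<noteq> {})"
proof -
  have "full_shift closure_of U = UNIV \<longleftrightarrow> (\<forall>T. openin full_shift T \<and> T \<noteq> {} \<longrightarrow> U \<inter> T \<noteq> {})"
    using dense_intersects_open[of full_shift U] by simp
  also have "\<dots> \<longleftrightarrow> (\<forall>p m. window p m \<inter> U \<noteq> {})"
  proof
    assume "\<forall>T. openin full_shift T \<and> T \<noteq> {} \<longrightarrow> U \<inter> T \<noteq> {}"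
    then have "U \<inter> window p m \<noteq> {}" for p m
      using openin_window[of p m] window_nonempty[of p m] by blast
    then show "\<forall>p m. window p m \<inter> U \<noteq> {}" by (simp add: inf_commute)
  next
    assume "\<forall>p m. window p m \<inter> U \<noteq> {}"
    then show "\<forall>T. openin full_shift T \<and> T \<noteq> {} \<longrightarrow> U \<inter> T \<noteq> {}"
      unfolding openin_full_shift_iff by blast
  qed
  finally show ?thesis .
qed

lemma compact_space_full_shift: "compact_space full_shift"
  by (simp add: full_shift_def compact_space_product_topology compact_space_discrete_topology)

lemma Hausdorff_space_full_shift: "Hausdorff_space full_shift"
  by (simp add: full_shift_def Hausdorff_space_product_topology)

lemma metrizable_space_full_shift: "metrizable_space full_shift"
  by (simp add: full_shift_def metrizable_space_product_topology)

lemma full_shift_Baire: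
  fixes \<G> :: "(int \<Rightarrow> 'a::finite) set set"
  assumes "countable \<G>" "\<And>T. T \<in> \<G> \<Longrightarrow> openin full_shift T \<and> full_shift closure_of T = UNIV"
  shows "full_shift closure_of \<Inter>\<G> = UNIV"
proof -
  have "locally_compact_space (full_shift :: (int \<Rightarrow> 'a) topology) \<and>
      regular_space (full_shift :: (int \<Rightarrow> 'a) topology)"
    by (intro conjI compact_imp_locally_compact_space compact_Hausdorff_imp_regular_space
        compact_space_full_shift Hausdorff_space_full_shift)
  then show ?thesis
    using Baire_category[of full_shift \<G>] assms by simp
qed

lemma full_shift_convergent_subsequence:
  fixes s :: "nat \<Rightarrow> int \<Rightarrow> 'a::finite"
  shows "\<exists>y r. strict_mono r \<and> limitin full_shift (s \<circ> r) y sequentially"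
proof -
  obtain M d where "Metric_space M d" and eq: "(full_shift :: (int \<Rightarrow> 'a) topology) = Metric_space.mtopology M d"
    using metrizable_space_full_shift unfolding metrizable_space_def by blast
  then interpret Metric_space M d by simp
  have "M = UNIV" using eq topspace_mtopology topspace_full_shift by metis
  moreover have "compact_space mtopology"
    using compact_space_full_shift[where 'a = 'a] eq by simp
  ultimately show ?thesis
    unfolding eq compact_space_sequentially by auto
qed

section \<open>Comeager realms of attraction\<close>

lemma comeager_Int:
  assumes "comeager T S" "comeager T S'"
  shows "comeager T (S \<inter> S')"
proof -
  obtain \<U> \<V> where "countable \<U>" "\<forall>U\<in>\<U>. openin T U \<and> T closure_of U = topspace T"
    "topspace T \<inter> \<Inter>\<U> \<subseteq> S" "countable \<V>" "\<forall>U\<in>\<V>. openin T U \<and> T closure_of U = topspace T"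
    "topspace T \<inter> \<Inter>\<V> \<subseteq> S'"
    using assms unfolding comeager_def by blast
  then have "countable (\<U> \<union> \<V>) \<and> (\<forall>U\<in>\<U> \<union> \<V>. openin T U \<and> T closure_of U = topspace T) \<and>
     topspace T \<inter> \<Inter>(\<U> \<union> \<V>) \<subseteq> S \<inter> S'"
    by auto
  then show ?thesis
    using assms unfolding comeager_def by (intro conjI exI[of _ "\<U> \<union> \<V>"]) auto
qed

lemma comeager_UNIV: "comeager full_shift UNIV"
  unfolding comeager_def by (auto intro!: exI[of _ "{}"])

lemma realm_Int: "realm f (C \<inter> D) = realm f C \<inter> realm f D"
  by (auto simp: realm_def)

text \<open>By compactness of \<open>V\<close>, finitely many of the closed sets defining the
  generic limit set already have an intersection missing \<open>V\<close>. Realms commute with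
  intersections, so this finite intersection still has a comeager realm.\<close>

lemma generic_limit_set_approx:
  assumes "closedin full_shift V" "V \<inter> generic_limit_set f = {}"
  obtains C where "closedin full_shift C" "comeager full_shift (realm f C)" "V \<inter> C = {}"
proof -
  define \<C> where "\<C> = {C. closedin full_shift C \<and> comeager full_shift (realm f C)}"
  have "compactin full_shift V"
    using assms(1) compact_space_full_shift closedin_compact_space by blast
  moreover have "V \<inter> \<Inter>\<C> = {}" using assms(2) by (simp add: generic_limit_set_def \<C>_def)
  moreover have "\<forall>C\<in>\<C>. closedin full_shift C" by (simp add: \<C>_def)
  ultimately have "\<not> (\<forall>\<F>. finite \<F> \<and> \<F> \<subseteq> \<C> \<longrightarrow> V \<inter> \<Inter>\<F> \<noteq> {})"
    unfolding compactin_fip by metis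
  then obtain \<F> where F: "finite \<F>" "\<F> \<subseteq> \<C>" "V \<inter> \<Inter>\<F> = {}"
    by blast
  have "closedin full_shift (\<Inter>\<F>) \<and> comeager full_shift (realm f (\<Inter>\<F>))"
    using F(1,2)
  proof (induction \<F>)
    case empty
    have "closedin full_shift (UNIV :: (int \<Rightarrow> 'a) set)"
      using closedin_topspace[of full_shift] by simp
    then show ?case by (simp add: realm_def comeager_UNIV)
  next
    case (insert C \<F>)
    then have "closedin full_shift C" "comeager full_shift (realm f C)" by (auto simp: \<C>_def)
    then show ?case using insert by (simp add: realm_Int comeager_Int closedin_Int)
  qed
  then show ?thesis using F(3) by (intro that) auto
qed

lemma cellular_automaton_continuous:
  "cellular_automaton UNIV f \<Longrightarrow> continuous_map full_shift full_shift f"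
  by (simp add: cellular_automaton_def)

lemma continuous_map_funpow:
  "continuous_map X X f \<Longrightarrow> continuous_map X X (f ^^ n)"
proof (induction n)
  case 0
  then show ?case by (simp add: id_def)
next
  case (Suc n)
  then have "continuous_map X X (f \<circ> (f ^^ n))"
    by (blast intro: continuous_map_compose)
  then show ?case by (simp only: funpow.simps)
qed

text \<open>One direction of the Curtis-Hedlund-Lyndon theorem: by continuity, cell 0 of the image
  is constant on a window around each point; finitely many such windows cover the space, and
  translation carries the bound to all cells.\<close>

lemma cellular_automaton_radius:
  assumes "cellular_automaton UNIV f"
  obtains R where "0 \<le> R" "has_radius R f"
proof -
  have comm: "f (translate k x) = translate k (f x)" for k x
    using assms by (intro commute_translate) (simp add: cellular_automaton_def)
  have "openin full_shift {y. f y 0 = a}" for a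
  proof -
    have "openin full_shift {z :: int \<Rightarrow> 'a. z 0 = a}"
      by (rule clopen_if_window_determined[of 0]) (auto simp: window_def)
    then show ?thesis
      using openin_continuous_map_preimage[OF cellular_automaton_continuous[OF assms], of "{z. z 0 = a}"]
      by simp
  qed
  then have "\<exists>m. window x m \<subseteq> {y. f y 0 = f x 0}" for x
    unfolding openin_full_shift_iff by simp
  then obtain m where m: "window x (m x) \<subseteq> {y. f y 0 = f x 0}" for x by metis
  have "(\<Union>x. window x (m x)) = topspace full_shift" using window_refl by fastforce
  moreover have "\<forall>U\<in>range (\<lambda>x. window x (m x)). openin full_shift U"
    using openin_window by blast
  ultimately have "\<exists>\<F>. finite \<F> \<and> \<F> \<subseteq> range (\<lambda>x. window x (m x)) \<and> \<Union>\<F> = topspace full_shift"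
    by (intro compact_space_full_shift[unfolded compact_space, THEN spec, THEN mp] conjI)
  then obtain \<F> where F: "finite \<F>" "\<F> \<subseteq> range (\<lambda>x. window x (m x))" "\<Union>\<F> = topspace full_shift"
    by (elim exE conjE)
  then obtain Z where Z: "finite Z" "\<F> = (\<lambda>x. window x (m x)) ` Z"
    by (meson finite_subset_image)
  define R where "R = (\<Sum>z\<in>Z. \<bar>m z\<bar>)"
  have mR: "m z \<le> R" if "z \<in> Z" for z
    using member_le_sum[of z Z "\<lambda>z. \<bar>m z\<bar>"] Z(1) that by (auto simp: R_def)
  have zero: "f x 0 = f y 0" if "y \<in> window x R" for x y
  proof -
    obtain z where z: "z \<in> Z" "x \<in> window z (m z)" using F(3) Z(2) by auto
    then have "y \<in> window z (m z)" using that mR[OF z(1)] by (auto simp: window_def)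
    then have "f x 0 = f z 0" "f y 0 = f z 0" using z m[of z] by auto
    then show ?thesis by simp
  qed
  have "has_radius R f" unfolding has_radius_def
  proof (intro allI impI)
    fix x y :: "int \<Rightarrow> 'a" and i
    assume "\<forall>j. \<bar>j - i\<bar> \<le> R \<longrightarrow> x j = y j"
    then have "translate i y \<in> window (translate i x) R" by (auto simp: window_def)
    then have "f (translate i x) 0 = f (translate i y) 0" by (rule zero)
    then show "f x i = f y i" by (simp add: comm)
  qed
  moreover have "0 \<le> R" by (simp add: R_def sum_nonneg)
  ultimately show ?thesis using that by blast
qed

text \<open>The Baire category theorem turns the pointwise time from which an orbit avoids a clopen set
  into a uniform one on some window.\<close>

lemma eventually_avoids:
  assumes ca: "cellular_automaton UNIV f"
    and V: "openin full_shift V" "closedin full_shift V" "V \<inter> generic_limit_set f = {}"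
  shows "\<exists>p' m' T. window p' m' \<subseteq> window p m \<and> (\<forall>x\<in>window p' m'. \<forall>t\<ge>T. (f ^^ t) x \<notin> V)"
proof -
  obtain C where C: "closedin full_shift C" "comeager full_shift (realm f C)" "V \<inter> C = {}"
    using generic_limit_set_approx[OF V(2,3)] .
  \<comment> \<open>The points whose orbits still visit \<open>V\<close> at time \<open>T\<close> or
    later. These sets are open, and no point of the realm of \<open>C\<close> lies in all of
    them.\<close>
  define E where "E T = {x. \<exists>t\<ge>T. (f ^^ t) x \<in> V}" for T
  have E_open: "openin full_shift (E T)" for T
  proof -
    have "openin full_shift {x \<in> topspace full_shift. (f ^^ t) x \<in> V}" for t
      using continuous_map_funpow[OF cellular_automaton_continuous[OF ca]] V(1)
      by (rule openin_continuous_map_preimage)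
    then have "openin full_shift (\<Union>t\<in>{T..}. {x. (f ^^ t) x \<in> V})" by auto
    moreover have "E T = (\<Union>t\<in>{T..}. {x. (f ^^ t) x \<in> V})" by (auto simp: E_def)
    ultimately show ?thesis by simp
  qed
  have realm_E: "\<exists>T. x \<notin> E T" if "x \<in> realm f C" for x
  proof (rule ccontr)
    assume "\<nexists>T. x \<notin> E T"
    then have inf: "\<exists>t\<ge>T. (f ^^ t) x \<in> V" for T by (auto simp: E_def)
    \<comment> \<open>Infinitely many visits to \<open>V\<close> accumulate at a point of the closed
      set \<open>V\<close>, whereas the realm puts that limit point into \<open>C\<close>.\<close>
    define S where "S = {t. (f ^^ t) x \<in> V}"
    have "infinite S"
      using inf by (simp add: S_def infinite_nat_iff_unbounded_le)
    then have r: "strict_mono (enumerate S)" "\<And>n. enumerate S n \<in> S"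
      by (auto simp: strict_mono_enumerate enumerate_in_set)
    obtain y r' where y: "strict_mono r'"
      "limitin full_shift ((\<lambda>n. (f ^^ enumerate S n) x) \<circ> r') y sequentially"
      using full_shift_convergent_subsequence by blast
    have "y \<in> omega_limit f x"
      unfolding omega_limit_def
      using strict_mono_o[OF r(1) y(1)] y(2)
      by (auto simp: o_def intro!: exI[of _ "enumerate S \<circ> r'"])
    moreover have "y \<in> V"
      using y(2) V(2) by (rule limitin_closedin) (use r(2) in \<open>auto simp: S_def\<close>)
    ultimately show False using that C(3) by (auto simp: realm_def)
  qed
  obtain \<U> where U: "countable \<U>" "\<forall>U\<in>\<U>. openin full_shift U \<and> full_shift closure_of U = UNIV"
     "\<Inter>\<U> \<subseteq> realm f C"
    using C(2) unfolding comeager_def by auto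
  show ?thesis
  proof (rule ccontr)
    assume "\<not> ?thesis"
    then have not: "\<exists>x\<in>window p' m'. x \<in> E T" if "window p' m' \<subseteq> window p m" for p' m' T
      using that unfolding E_def by blast
    \<comment> \<open>If the claim fails, \<open>E T\<close> meets every window inside
      \<open>window p m\<close>; adding the complement makes it dense everywhere. Baire then yields
      a point of \<open>window p m\<close> in the realm of \<open>C\<close> and in every
      \<open>E T\<close>.\<close>
    have "full_shift closure_of \<Inter>(\<U> \<union> range (\<lambda>T. E T \<union> - window p m)) = UNIV"
    proof (rule full_shift_Baire)
      show "countable (\<U> \<union> range (\<lambda>T. E T \<union> - window p m))" using U(1) by simp
      fix A assume "A \<in> \<U> \<union> range (\<lambda>T. E T \<union> - window p m)"
      then consider "A \<in> \<U>" | T where "A = E T \<union> - window p m" by blast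
      then show "openin full_shift A \<and> full_shift closure_of A = UNIV"
      proof cases
        case 2
        have op: "openin full_shift (- window p m)"
          using closedin_window[of p m] by (simp add: closedin_def Compl_eq_Diff_UNIV)
        have "window q l \<inter> A \<noteq> {}" for q l
        proof (cases "window q l \<subseteq> - window p m")
          case False
          then obtain x where x: "x \<in> window q l" "x \<in> window p m" by blast
          have "window x (max l m) \<subseteq> window q l \<inter> window p m"
            using x by (auto simp: window_def)
          then show ?thesis using not[of x "max l m" T] 2 by blast
        qed (use 2 window_refl in blast)
        then show ?thesis
          using 2 op E_open dense_full_shift_iff[of A] by (simp add: openin_Un del: closure_of_Un)
      qed (use U(2) in blast)
    qed
    then have "window p m \<inter> \<Inter>(\<U> \<union> range (\<lambda>T. E T \<union> - window p m)) \<noteq> {}"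
      unfolding dense_full_shift_iff by blast
    then obtain x where "x \<in> window p m" "x \<in> \<Inter>\<U>" "\<And>T. x \<in> E T"
      by auto
    then show False using realm_E U(3) by blast
  qed
qed

text \<open>Otherwise the windows whose orbits uniformly miss \<open>V\<close> from some time on
  have a dense open union. It lies in the realm of the closed set \<open>- V\<close>, so the generic
  limit set would be disjoint from \<open>V\<close>.\<close>

lemma generic_limit_set_recurrent:
  assumes V: "openin full_shift V" "V \<inter> generic_limit_set f \<noteq> {}"
  shows "\<exists>q l. \<forall>p m T. window p m \<subseteq> window q l \<longrightarrow> (\<exists>t\<ge>T. \<exists>x\<in>window p m. (f ^^ t) x \<in> V)"
proof (rule ccontr)
  assume no_such: "\<not> ?thesis"
  have neg: "\<exists>p m T. window p m \<subseteq> window q l \<and> (\<forall>t\<ge>T. \<forall>x\<in>window p m. (f ^^ t) x \<notin> V)" for q l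
  proof (rule ccontr)
    assume none: "\<not> (\<exists>p m T. window p m \<subseteq> window q l \<and> (\<forall>t\<ge>T. \<forall>x\<in>window p m. (f ^^ t) x \<notin> V))"
    have "\<exists>t\<ge>T. \<exists>x\<in>window p m. (f ^^ t) x \<in> V" if "window p m \<subseteq> window q l" for p m T
    proof (rule ccontr)
      assume "\<not> (\<exists>t\<ge>T. \<exists>x\<in>window p m. (f ^^ t) x \<in> V)"
      then have "\<forall>t\<ge>T. \<forall>x\<in>window p m. (f ^^ t) x \<notin> V" by simp
      with that none show False by (elim notE) (intro exI conjI)
    qed
    then have "\<forall>p m T. window p m \<subseteq> window q l \<longrightarrow> (\<exists>t\<ge>T. \<exists>x\<in>window p m. (f ^^ t) x \<in> V)"
      by (intro allI impI)
    with no_such show False by (elim notE) (intro exI)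
  qed
  define U where "U = \<Union>{window p m | p m. \<exists>T. \<forall>t\<ge>T. \<forall>x\<in>window p m. (f ^^ t) x \<notin> V}"
  have "openin full_shift U"
    unfolding U_def by (rule openin_Union) (auto intro: openin_window)
  moreover have "full_shift closure_of U = UNIV"
    unfolding dense_full_shift_iff
  proof (intro allI)
    fix q l
    obtain p m T where *: "window p m \<subseteq> window q l" "\<forall>t\<ge>T. \<forall>x\<in>window p m. (f ^^ t) x \<notin> V"
      using neg by blast
    then have "window p m \<subseteq> U" unfolding U_def by blast
    then show "window q l \<inter> U \<noteq> {}" using * window_refl by blast
  qed
  moreover have "U \<subseteq> realm f (- V)"
  proof
    fix x assume "x \<in> U"
    then obtain T where T: "\<forall>t\<ge>T. (f ^^ t) x \<notin> V" unfolding U_def by blast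
    have "y \<notin> V" if y: "y \<in> omega_limit f x" for y
    proof
      assume "y \<in> V"
      obtain r where r: "strict_mono r" "limitin full_shift (\<lambda>n. (f ^^ r n) x) y sequentially"
        using y unfolding omega_limit_def by blast
      then have "eventually (\<lambda>n. (f ^^ r n) x \<in> V) sequentially"
        using V(1) \<open>y \<in> V\<close> unfolding limitin_def by blast
      then obtain N where N: "\<And>n. N \<le> n \<Longrightarrow> (f ^^ r n) x \<in> V"
        unfolding eventually_sequentially by blast
      have "T \<le> r (max N T)"
        using strict_mono_imp_increasing[OF r(1), of "max N T"] by simp
      then show False using N[of "max N T"] T by simp
    qed
    then show "x \<in> realm f (- V)" by (auto simp: realm_def)
  qed
  ultimately have "comeager full_shift (realm f (- V))"
    unfolding comeager_def by (intro conjI exI[of _ "{U}"]) auto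
  moreover have "closedin full_shift (- V)"
    using V(1) by (simp add: closedin_def Compl_eq_Diff_UNIV double_diff)
  ultimately have "generic_limit_set f \<subseteq> - V"
    unfolding generic_limit_set_def by blast
  then show False using V(2) by blast
qed

section \<open>The language of an oblique generic limit set\<close>

text \<open>The sign \<open>s\<close> encodes the side, so both directions share one proof. The
  finite \<open>K\<close> matters because points will resemble \<open>X\<close> only on a window,
  the positive exponent because later inductions go back in time by that many steps.\<close>

lemma oblique_neighborhood_bounded:
  assumes nb: "ca_neighborhood X (f ^^ n) N" and s: "s = 1 \<or> s = - 1" and N: "\<And>j. j \<in> N \<Longrightarrow> 0 < s * j"
    and radius: "has_radius R f" and "0 \<le> R"
  obtains n' K where "0 < n'"
    and "\<forall>x\<in>X. \<forall>y\<in>X. (\<forall>j. 0 < s * j \<and> s * j \<le> K \<longrightarrow> x j = y j) \<longrightarrow>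
           (f ^^ n') x 0 = (f ^^ n') y 0"
proof -
  obtain F where F: "\<And>x i. x \<in> X \<Longrightarrow> (f ^^ n) x i = F (restrict (\<lambda>j. x (i + j)) N)"
    and "finite N"
    using nb unfolding ca_neighborhood_def by blast
  define B where "B = (\<Sum>j\<in>N. \<bar>j\<bar>)"
  have "\<bar>j\<bar> \<le> B" if "j \<in> N" for j
    using member_le_sum[of j N abs] \<open>finite N\<close> that by (auto simp: B_def)
  then have B: "s * j \<le> B" if "j \<in> N" for j
    using that s by fastforce
  have step: "(f ^^ n) x i = (f ^^ n) y i"
    if "x \<in> X" "y \<in> X" "\<And>j. j \<in> N \<Longrightarrow> x (i + j) = y (i + j)" for x y i
    using F that by (simp cong: restrict_cong)
  show ?thesis
  proof (cases "n = 0")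
    case False
    have *: "(f ^^ n) x 0 = (f ^^ n) y 0"
      if X: "x \<in> X" "y \<in> X" and eq: "\<forall>j. 0 < s * j \<and> s * j \<le> B \<longrightarrow> x j = y j" for x y
    proof (rule step[OF X])
      show "x (0 + j) = y (0 + j)" if "j \<in> N" for j
        using eq N[OF that] B[OF that] by simp
    qed
    have "0 < n" using False by simp
    then show ?thesis by (rule that[of n B]) (intro ballI impI *)
  next
    case True
    text \<open>The identity on \<open>X\<close> has an oblique neighborhood, so points of \<open>X\<close> that agree on a long
      interval agree all along the half line behind it.\<close>
    have *: "f x 0 = f y 0"
      if X: "x \<in> X" "y \<in> X" and eq: "\<forall>j. 0 < s * j \<and> s * j \<le> B + R \<longrightarrow> x j = y j" for x y
    proof -
      have behind: "x (s * i) = y (s * i)" if "- int d < i" "i \<le> B + R" for d i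
        using that
      proof (induction d arbitrary: i)
        case 0
        then show ?case using s eq by auto
      next
        case (Suc d)
        show ?case
        proof (cases "i = - int d")
          case True
          have "x (s * i + j) = y (s * i + j)" if "j \<in> N" for j
          proof -
            have "s * i + j = s * (i + s * j)" using s by auto
            then show ?thesis
              using Suc.IH[of "i + s * j"] N[OF that] B[OF that] True \<open>0 \<le> R\<close> by simp
          qed
          then show ?thesis using step[OF X, of "s * i"] \<open>n = 0\<close> by simp
        qed (use Suc in auto)
      qed
      have "0 \<le> B" by (simp add: B_def sum_nonneg)
      show ?thesis
      proof (rule has_radiusD[OF radius])
        fix j assume "\<bar>j - 0\<bar> \<le> R"
        then show "x j = y j"
          using behind[of "nat (R + 1)" "s * j"] s \<open>0 \<le> B\<close> \<open>0 \<le> R\<close> by auto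
      qed
    qed
    have **: "(f ^^ 1) x 0 = (f ^^ 1) y 0"
      if "x \<in> X" "y \<in> X" "\<forall>j. 0 < s * j \<and> s * j \<le> B + R \<longrightarrow> x j = y j" for x y
      using *[OF that] by simp
    show ?thesis by (rule that[OF zero_less_one, of "B + R"]) (intro ballI impI **)
  qed
qed

lemma generic_limit_set_shadowing:
  assumes ca: "cellular_automaton UNIV f"
    and oblique: "eventually_oblique (generic_limit_set f) f"
  shows "\<exists>p' m' T. window p' m' \<subseteq> window q l \<and>
     (\<forall>x\<in>window p' m'. \<exists>y\<in>window p m. \<forall>t\<ge>T. \<forall>i. \<bar>i\<bar> \<le> k \<longrightarrow> (f ^^ t) x i = (f ^^ t) y i)"
proof -
  define X where "X = generic_limit_set f"
  obtain R where R: "0 \<le> R" "has_radius R f"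
    using cellular_automaton_radius[OF ca] .
  have comm: "f (translate k x) = translate k (f x)" for k x
    using ca by (intro commute_translate) (simp add: cellular_automaton_def)
  obtain n0 N where nb: "ca_neighborhood X (f ^^ n0) N" and side: "N \<subseteq> {..-1} \<or> N \<subseteq> {1..}"
    using oblique unfolding eventually_oblique_def X_def by blast
  obtain s :: int where s: "s = 1 \<or> s = - 1" "\<And>j. j \<in> N \<Longrightarrow> 0 < s * j"
  proof (cases "N \<subseteq> {1..}")
    case True
    then show ?thesis by (intro that[of 1]) auto
  next
    case False
    with side show ?thesis by (intro that[of "- 1"]) auto
  qed
  obtain n K where n: "0 < n" and K: "\<forall>x\<in>X. \<forall>y\<in>X. (\<forall>j. 0 < s * j \<and> s * j \<le> K \<longrightarrow> x j = y j) \<longrightarrow>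
           (f ^^ n) x 0 = (f ^^ n) y 0"
    using oblique_neighborhood_bounded[OF nb s R(2,1)] .
  \<comment> \<open>\<open>K\<close> makes the oblique rule applicable to nearby points of
    \<open>X\<close>; \<open>int n * R\<close> makes their images under \<open>f ^^ n\<close> agree
    at 0 with those of the original points.\<close>
  define L where "L = max K (int n * R)"
  define G where "G x \<longleftrightarrow> (\<exists>y\<in>X. y \<in> window x L)" for x
  have G_oblique: "(f ^^ n) x 0 = (f ^^ n) y 0"
    if G: "G x" "G y" and eq: "\<And>j. 0 < s * j \<Longrightarrow> x j = y j" for x y
  proof -
    obtain x' y' where x': "x' \<in> X" "\<And>j. \<bar>j\<bar> \<le> L \<Longrightarrow> x' j = x j"
      and y': "y' \<in> X" "\<And>j. \<bar>j\<bar> \<le> L \<Longrightarrow> y' j = y j"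
      using G by (auto simp: G_def window_def)
    have "(f ^^ n) x' 0 = (f ^^ n) y' 0"
    proof (rule K[rule_format, OF x'(1) y'(1)])
      fix j assume j: "0 < s * j \<and> s * j \<le> K"
      then have "\<bar>j\<bar> \<le> L" using s(1) by (auto simp: L_def)
      then show "x' j = y' j" using x' y' eq j by simp
    qed
    moreover have "(f ^^ n) x' 0 = (f ^^ n) x 0" "(f ^^ n) y' 0 = (f ^^ n) y 0"
      by (rule has_radiusD[OF has_radius_funpow[OF R(2,1)]]; simp add: x' y' L_def)+
    ultimately show ?thesis by simp
  qed
  have G_settle: "\<exists>p' m' T. window p' m' \<subseteq> window p m \<and> (\<forall>x\<in>window p' m'. \<forall>t\<ge>T. G ((f ^^ t) x))" for p m
  proof -
    have G_window: "G x \<longleftrightarrow> G y" if "y \<in> window x L" for x y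
    proof -
      have "window y L = window x L" using that by (auto simp: window_def)
      then show ?thesis by (simp add: G_def)
    qed
    \<comment> \<open>Failure of \<open>G\<close> is decided by a finite window, hence clopen, and
      never happens on the generic limit set, so \<open>eventually_avoids\<close> applies.\<close>
    have "openin full_shift {x. \<not> G x}" "closedin full_shift {x. \<not> G x}"
      using G_window by (auto intro!: clopen_if_window_determined[of L])
    moreover have "{x. \<not> G x} \<inter> generic_limit_set f = {}"
      using window_refl by (auto simp: G_def X_def)
    ultimately show ?thesis
      using eventually_avoids[OF ca, of "{x. \<not> G x}"] by simp
  qed
  from s(1) show ?thesis
  proof
    assume "s = 1"
    have *: "(f ^^ n) x 0 = (f ^^ n) y 0" if "G x" "G y" "\<And>j. 0 < j \<Longrightarrow> x j = y j" for x y
      using that \<open>s = 1\<close> by (intro G_oblique) auto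
    interpret settling_oblique f R n G
      by (rule settling_oblique.intro[OF comm R(2,1) n G_settle *])
    show ?thesis by (rule shadowing)
  next
    assume "s = - 1"
    have "(f ^^ n) x 0 = (f ^^ n) y 0" if "G x" "G y" "\<And>j. j < 0 \<Longrightarrow> x j = y j" for x y
      using that \<open>s = - 1\<close> by (intro G_oblique) auto
    then show ?thesis
      by (rule shadowing_left[OF comm R(2,1) n G_settle])
  qed
qed

text \<open>Forward, some window has visits to the cylinder from all its subwindows, and shadowing
  copies these visits to any prescribed window. Conversely, a cylinder missing the limit set is
  eventually avoided on some window.\<close>

lemma language_generic_limit_set_iff:
  assumes ca: "cellular_automaton UNIV f"
    and oblique: "eventually_oblique (generic_limit_set f) f"
  shows "w \<in> language (generic_limit_set f) \<longleftrightarrow>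
     (\<forall>p m T. \<exists>t\<ge>T. \<exists>x\<in>window p m. (f ^^ t) x \<in> cylinder w)"
proof
  have clopen: "openin full_shift (cylinder w)" "closedin full_shift (cylinder w)"
    by (rule clopen_if_window_determined[of "int (length w)"]; auto simp: window_def cylinder_def)+
  {
    assume "w \<in> language (generic_limit_set f)"
    then obtain q l where ql: "\<And>p m T. window p m \<subseteq> window q l \<Longrightarrow>
        \<exists>t\<ge>T. \<exists>x\<in>window p m. (f ^^ t) x \<in> cylinder w"
      using generic_limit_set_recurrent[OF clopen(1), of f] unfolding language_def by blast
    show "\<forall>p m T. \<exists>t\<ge>T. \<exists>x\<in>window p m. (f ^^ t) x \<in> cylinder w"
    proof (intro allI)
      fix p m T
      obtain p' m' T' where *: "window p' m' \<subseteq> window q l"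
        "\<forall>x\<in>window p' m'. \<exists>y\<in>window p m. \<forall>t\<ge>T'. \<forall>i. \<bar>i\<bar> \<le> int (length w) \<longrightarrow> (f ^^ t) x i = (f ^^ t) y i"
        using generic_limit_set_shadowing[OF assms, of q l p m "int (length w)"] by blast
      obtain t x where t: "max T T' \<le> t" "x \<in> window p' m'" "(f ^^ t) x \<in> cylinder w"
        using ql[OF *(1), of "max T T'"] by blast
      then obtain y where y: "y \<in> window p m" "\<And>i. \<bar>i\<bar> \<le> int (length w) \<Longrightarrow> (f ^^ t) x i = (f ^^ t) y i"
        using *(2) by (meson max.boundedE)
      have "(f ^^ t) y \<in> cylinder w"
        using t(3) y(2) by (auto simp: cylinder_def)
      then show "\<exists>t\<ge>T. \<exists>x\<in>window p m. (f ^^ t) x \<in> cylinder w"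
        using t(1) y(1) by (meson max.boundedE)
    qed
  }
  {
    assume rec: "\<forall>p m T. \<exists>t\<ge>T. \<exists>x\<in>window p m. (f ^^ t) x \<in> cylinder w"
    show "w \<in> language (generic_limit_set f)"
    proof (rule ccontr)
      assume "w \<notin> language (generic_limit_set f)"
      then have "cylinder w \<inter> generic_limit_set f = {}" by (simp add: language_def)
      then obtain p m T where "\<forall>x\<in>window p m. \<forall>t\<ge>T. (f ^^ t) x \<notin> cylinder w"
        using eventually_avoids[OF ca clopen, of "\<lambda>_. undefined" 0] by blast
      then show False using rec by blast
    qed
  }
qed

section \<open>Total recursive functions\<close>

named_theorems recursive_intros

lemma total_recursive_extI:
  "total_recursive k f \<Longrightarrow> (\<And>xs. length xs = k \<Longrightarrow> g xs = f xs) \<Longrightarrow> total_recursive k g"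
  by (rule rec_ext) auto

lemma total_recursive_const [recursive_intros]: "total_recursive k (\<lambda>_. c)"
proof (induction c)
  case 0
  show ?case by (rule rec_zero)
next
  case (Suc c)
  have "total_recursive k (\<lambda>xs. (\<lambda>ys. Suc (ys ! 0)) (map (\<lambda>g. g xs) [\<lambda>_. c]))"
    using Suc rec_Suc by (intro rec_comp) auto
  then show ?case by simp
qed

lemma total_recursive_nth [recursive_intros]: "i < k \<Longrightarrow> total_recursive k (\<lambda>xs. xs ! i)"
  by (rule rec_proj)

text \<open>A bounded quantifier puts its variable at the head of the argument list and leaves the
  rest as \<open>tl\<close>. Under the bounded search for \<open>t\<close>, \<open>diagram\<close>
  nests them three deep, hence the versions with up to three \<open>tl\<close>.\<close>

lemma total_recursive_nth_tl [recursive_intros]: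
  "Suc i < k \<Longrightarrow> total_recursive k (\<lambda>xs. tl xs ! i)"
  by (rule total_recursive_extI[OF rec_proj[of "Suc i"]]) (auto simp: nth_tl)

lemma total_recursive_nth_tl2 [recursive_intros]:
  "Suc (Suc i) < k \<Longrightarrow> total_recursive k (\<lambda>xs. tl (tl xs) ! i)"
  by (rule total_recursive_extI[OF rec_proj[of "Suc (Suc i)"]]) (auto simp: nth_tl)

lemma total_recursive_nth_tl3 [recursive_intros]:
  "Suc (Suc (Suc i)) < k \<Longrightarrow> total_recursive k (\<lambda>xs. tl (tl (tl xs)) ! i)"
  by (rule total_recursive_extI[OF rec_proj[of "Suc (Suc (Suc i))"]]) (auto simp: nth_tl)

lemma total_recursive_comp:
  assumes "total_recursive m f" "length gs = m" "\<And>g. g \<in> set gs \<Longrightarrow> total_recursive k g"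
    and "\<And>xs. length xs = k \<Longrightarrow> h xs = f (map (\<lambda>g. g xs) gs)"
  shows "total_recursive k h"
  using assms by (intro total_recursive_extI[OF rec_comp[of gs f k]]) auto

lemma map_projections: "length xs = k \<Longrightarrow> map (\<lambda>i. xs ! i) [0..<k] = xs"
  by (metis map_nth)

lemma total_recursive_tl_tl:
  assumes "total_recursive k g"
  shows "total_recursive (Suc (Suc k)) (\<lambda>ys. g (tl (tl ys)))"
proof (rule total_recursive_comp[OF assms, of "map (\<lambda>i ys. ys ! Suc (Suc i)) [0..<k]"])
  fix ys :: "nat list" assume "length ys = Suc (Suc k)"
  then obtain a b xs where "ys = a # b # xs" "length xs = k"
    by (metis length_Suc_conv)
  then show "g (tl (tl ys)) = g (map (\<lambda>h. h ys) (map (\<lambda>i ys. ys ! Suc (Suc i)) [0..<k]))"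
    using map_projections[of xs k] by (simp add: o_def)
qed (auto intro: rec_proj)

lemma total_recursive_nth_0_tl_tl:
  assumes "total_recursive (Suc k) g"
  shows "total_recursive (Suc (Suc k)) (\<lambda>ys. g (ys ! 0 # tl (tl ys)))"
proof (rule total_recursive_comp[OF assms, of "(\<lambda>ys. ys ! 0) # map (\<lambda>i ys. ys ! Suc (Suc i)) [0..<k]"])
  fix ys :: "nat list" assume "length ys = Suc (Suc k)"
  then obtain a b xs where "ys = a # b # xs" "length xs = k"
    by (metis length_Suc_conv)
  then show "g (ys ! 0 # tl (tl ys)) =
      g (map (\<lambda>h. h ys) ((\<lambda>ys. ys ! 0) # map (\<lambda>i ys. ys ! Suc (Suc i)) [0..<k]))"
    using map_projections[of xs k] by (simp add: o_def)
qed (auto intro: rec_proj)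

text \<open>\<open>rec_primrec\<close> recurses on its first argument; composition with
  \<open>n\<close> followed by all projections allows a computed bound.\<close>

lemma total_recursive_rec_nat:
  assumes "total_recursive k b" "total_recursive (Suc (Suc k)) (\<lambda>ys. s (ys ! 0) (ys ! 1) (tl (tl ys)))"
    and "total_recursive k n"
  shows "total_recursive k (\<lambda>xs. rec_nat (b xs) (\<lambda>i r. s i r xs) (n xs))"
proof (rule total_recursive_comp[OF rec_primrec[OF assms(1,2)],
      of "n # map (\<lambda>i ys. ys ! i) [0..<k]"])
  fix xs :: "nat list" assume "length xs = k"
  then show "rec_nat (b xs) (\<lambda>i r. s i r xs) (n xs) =
      rec_nat (b (tl (map (\<lambda>g. g xs) (n # map (\<lambda>i ys. ys ! i) [0..<k]))))
       (\<lambda>i r. s ((i # r # tl (map (\<lambda>g. g xs) (n # map (\<lambda>i ys. ys ! i) [0..<k]))) ! 0)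
          ((i # r # tl (map (\<lambda>g. g xs) (n # map (\<lambda>i ys. ys ! i) [0..<k]))) ! 1)
          (tl (tl (i # r # tl (map (\<lambda>g. g xs) (n # map (\<lambda>i ys. ys ! i) [0..<k]))))))
       (hd (map (\<lambda>g. g xs) (n # map (\<lambda>i ys. ys ! i) [0..<k])))"
    using map_projections[of xs k] by (simp add: o_def)
qed (auto intro: rec_proj assms(3))

lemma total_recursive_Suc [recursive_intros]:
  "total_recursive k f \<Longrightarrow> total_recursive k (\<lambda>xs. Suc (f xs))"
  by (rule total_recursive_comp[OF rec_Suc, of "[f]"]) auto

lemma total_recursive_add [recursive_intros]:
  assumes "total_recursive k f" "total_recursive k g"
  shows "total_recursive k (\<lambda>xs. f xs + g xs)"
proof -
  have "rec_nat a (\<lambda>i r. Suc r) b = a + b" for a b by (induction b) auto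
  moreover have "total_recursive k (\<lambda>xs. rec_nat (f xs) (\<lambda>i r. Suc r) (g xs))"
    by (rule total_recursive_rec_nat) (use assms in \<open>auto intro!: recursive_intros\<close>)
  ultimately show ?thesis by simp
qed

lemma total_recursive_mult [recursive_intros]:
  assumes "total_recursive k f" "total_recursive k g"
  shows "total_recursive k (\<lambda>xs. f xs * g xs)"
proof -
  have "rec_nat 0 (\<lambda>i r. a + r) b = a * b" for a b :: nat by (induction b) auto
  moreover have "total_recursive k (\<lambda>xs. rec_nat 0 (\<lambda>i r. f xs + r) (g xs))"
    by (rule total_recursive_rec_nat)
      (use assms in \<open>auto intro!: recursive_intros total_recursive_tl_tl\<close>)
  ultimately show ?thesis by simp
qed

lemma total_recursive_power [recursive_intros]:
  assumes "total_recursive k f" "total_recursive k g"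
  shows "total_recursive k (\<lambda>xs. f xs ^ g xs)"
proof -
  have "rec_nat 1 (\<lambda>i r. a * r) b = a ^ b" for a b :: nat by (induction b) auto
  moreover have "total_recursive k (\<lambda>xs. rec_nat 1 (\<lambda>i r. f xs * r) (g xs))"
    by (rule total_recursive_rec_nat)
      (use assms in \<open>auto intro!: recursive_intros total_recursive_tl_tl\<close>)
  ultimately show ?thesis by simp
qed

lemma total_recursive_diff [recursive_intros]:
  assumes "total_recursive k f" "total_recursive k g"
  shows "total_recursive k (\<lambda>xs. f xs - g xs)"
proof -
  have pred: "total_recursive k (\<lambda>xs. h xs - 1)" if "total_recursive k h" for h k
  proof -
    have "rec_nat 0 (\<lambda>i r. i) a = a - 1" for a :: nat by (induction a) auto
    moreover have "total_recursive k (\<lambda>xs. rec_nat 0 (\<lambda>i r. i) (h xs))"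
      by (rule total_recursive_rec_nat) (use that in \<open>auto intro!: recursive_intros\<close>)
    ultimately show ?thesis by simp
  qed
  have "rec_nat a (\<lambda>i r. r - 1) b = a - b" for a b :: nat by (induction b) auto
  moreover have "total_recursive k (\<lambda>xs. rec_nat (f xs) (\<lambda>i r. r - 1) (g xs))"
    by (rule total_recursive_rec_nat) (use assms in \<open>auto intro!: recursive_intros pred[unfolded One_nat_def]\<close>)
  ultimately show ?thesis by simp
qed

lemma total_recursive_if_eq_0:
  assumes "total_recursive k c" "total_recursive k f" "total_recursive k g"
  shows "total_recursive k (\<lambda>xs. if c xs = 0 then f xs else g xs)"
proof -
  have "rec_nat a (\<lambda>i r. b) n = (if n = 0 then a else b)" for a b n :: nat by (cases n) auto
  moreover have "total_recursive k (\<lambda>xs. rec_nat (f xs) (\<lambda>i r. g xs) (c xs))"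
    by (rule total_recursive_rec_nat)
      (use assms in \<open>auto intro!: recursive_intros total_recursive_tl_tl\<close>)
  ultimately show ?thesis by simp
qed

lemma total_recursive_if [recursive_intros]:
  assumes "decidable_rel k P" "total_recursive k f" "total_recursive k g"
  shows "total_recursive k (\<lambda>xs. if P xs then f xs else g xs)"
  using total_recursive_if_eq_0[OF assms(1)[unfolded decidable_rel_def] assms(3,2)]
  by (rule total_recursive_extI) auto

section \<open>Decidable relations, bounded quantifiers, division and tables\<close>

lemma decidable_rel_Not [recursive_intros]: "decidable_rel k P \<Longrightarrow> decidable_rel k (\<lambda>xs. \<not> P xs)"
  unfolding decidable_rel_def[of k "\<lambda>xs. \<not> P xs"]
  by (rule total_recursive_extI[OF total_recursive_if[of k P "\<lambda>_. 0" "\<lambda>_. 1"]])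
    (auto intro: recursive_intros)

lemma decidable_rel_conj [recursive_intros]:
  assumes "decidable_rel k P" "decidable_rel k Q"
  shows "decidable_rel k (\<lambda>xs. P xs \<and> Q xs)"
  unfolding decidable_rel_def[of k "\<lambda>xs. P xs \<and> Q xs"]
  by (rule total_recursive_extI[OF total_recursive_if[of k P "\<lambda>xs. if Q xs then 1 else 0" "\<lambda>_. 0"]])
    (use assms in \<open>auto intro!: recursive_intros\<close>)

lemma decidable_rel_imp [recursive_intros]:
  assumes "decidable_rel k P" "decidable_rel k Q"
  shows "decidable_rel k (\<lambda>xs. P xs \<longrightarrow> Q xs)"
proof -
  have "decidable_rel k (\<lambda>xs. \<not> (P xs \<and> \<not> Q xs))"
    using assms by (intro recursive_intros)
  then show ?thesis by simp
qed

lemma decidable_rel_le [recursive_intros]: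
  assumes "total_recursive k f" "total_recursive k g"
  shows "decidable_rel k (\<lambda>xs. f xs \<le> g xs)"
  unfolding decidable_rel_def
  by (rule total_recursive_extI[OF total_recursive_if_eq_0[of k "\<lambda>xs. f xs - g xs" "\<lambda>_. 1" "\<lambda>_. 0"]])
    (use assms in \<open>auto intro!: recursive_intros\<close>)

lemma decidable_rel_less [recursive_intros]:
  assumes "total_recursive k f" "total_recursive k g"
  shows "decidable_rel k (\<lambda>xs. f xs < g xs)"
proof -
  have "decidable_rel k (\<lambda>xs. Suc (f xs) \<le> g xs)"
    using assms by (intro recursive_intros)
  then show ?thesis by (simp add: Suc_le_eq)
qed

lemma decidable_rel_eq [recursive_intros]:
  assumes "total_recursive k f" "total_recursive k g"
  shows "decidable_rel k (\<lambda>xs. f xs = g xs)"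
proof -
  have "decidable_rel k (\<lambda>xs. f xs \<le> g xs \<and> g xs \<le> f xs)"
    using assms by (intro recursive_intros)
  then show ?thesis by (simp add: eq_iff)
qed

lemma decidable_rel_bounded_ex [recursive_intros]:
  assumes P: "decidable_rel (Suc k) (\<lambda>ys. P (ys ! 0) (tl ys))" and n: "total_recursive k n"
  shows "decidable_rel k (\<lambda>xs. \<exists>i<n xs. P i xs)"
proof -
  have eq: "rec_nat 0 (\<lambda>i r. if Q i then 1 else r) m = (if \<exists>i<m. Q i then 1 else (0::nat))" for Q m
    by (induction m) (auto simp: less_Suc_eq)
  have "decidable_rel (Suc (Suc k)) (\<lambda>ys. P (ys ! 0) (tl (tl ys)))"
    using total_recursive_nth_0_tl_tl[OF P[unfolded decidable_rel_def]]
    by (simp add: decidable_rel_def)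
  then have "total_recursive k (\<lambda>xs. rec_nat 0 (\<lambda>i r. if P i xs then 1 else r) (n xs))"
    using n by (intro total_recursive_rec_nat recursive_intros) auto
  then show ?thesis by (simp add: eq decidable_rel_def)
qed

lemma decidable_rel_bounded_all [recursive_intros]:
  assumes "decidable_rel (Suc k) (\<lambda>ys. P (ys ! 0) (tl ys))" "total_recursive k n"
  shows "decidable_rel k (\<lambda>xs. \<forall>i<n xs. P i xs)"
proof -
  have "decidable_rel k (\<lambda>xs. \<not> (\<exists>i<n xs. \<not> P i xs))"
    using assms by (intro recursive_intros)
  then show ?thesis by simp
qed

text \<open>Division by counting: the quotient rises exactly when the next multiple of
  \<open>y\<close> is reached.\<close>

lemma rec_nat_eq_div:
  fixes y :: nat
  assumes "0 < y"
  shows "rec_nat 0 (\<lambda>i r. if Suc r * y \<le> Suc i then Suc r else r) x = x div y"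
proof (induction x)
  case (Suc x)
  have "Suc (x div y) * y \<le> Suc x \<longleftrightarrow> Suc (x div y) \<le> Suc x div y"
    using assms by (simp add: less_eq_div_iff_mult_less_eq)
  with Suc show ?case by (auto simp: div_Suc)
qed simp

lemma total_recursive_div [recursive_intros]:
  assumes "total_recursive k f" "total_recursive k g"
  shows "total_recursive k (\<lambda>xs. f xs div g xs)"
proof -
  have "total_recursive k
     (\<lambda>xs. rec_nat 0 (\<lambda>i r. if Suc r * g xs \<le> Suc i then Suc r else r) (f xs))"
    using assms by (intro total_recursive_rec_nat recursive_intros total_recursive_tl_tl) auto
  \<comment> \<open>Division by 0 yields 0 in HOL, while the counting recursion would then rise at
    every step.\<close>
  then have "total_recursive k (\<lambda>xs. if g xs = 0 then 0 else
      rec_nat 0 (\<lambda>i r. if Suc r * g xs \<le> Suc i then Suc r else r) (f xs))"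
    using assms by (intro recursive_intros)
  then show ?thesis
    by (rule total_recursive_extI) (simp add: rec_nat_eq_div del: mult_Suc)
qed

lemma total_recursive_mod [recursive_intros]:
  assumes "total_recursive k f" "total_recursive k g"
  shows "total_recursive k (\<lambda>xs. f xs mod g xs)"
proof -
  have "total_recursive k (\<lambda>xs. f xs - f xs div g xs * g xs)"
    using assms by (intro recursive_intros)
  then show ?thesis by (simp add: minus_div_mult_eq_mod)
qed

text \<open>A finite table is recursive however its entries are given. This is how the local rule of
  an arbitrary automaton enters the computation.\<close>

lemma total_recursive_table [recursive_intros]:
  assumes "total_recursive k g"
  shows "total_recursive k (\<lambda>xs. if g xs < m then tab (g xs) else 0)"
proof (induction m)
  case 0
  show ?case by (simp add: total_recursive_const)
next
  case (Suc m)
  have "total_recursive k (\<lambda>xs. if g xs = m then tab m else if g xs < m then tab (g xs) else 0)"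
    using assms Suc by (rule total_recursive_if[OF decidable_rel_eq[OF _ total_recursive_const] total_recursive_const])
  then show ?case by (rule total_recursive_extI) auto
qed

lemma total_recursive_funpow:
  assumes h: "\<And>k g. total_recursive k g \<Longrightarrow> total_recursive k (\<lambda>xs. h (g xs))"
    and "total_recursive k n" "total_recursive k g"
  shows "total_recursive k (\<lambda>xs. (h ^^ n xs) (g xs))"
proof -
  have "rec_nat a (\<lambda>i r. h r) m = (h ^^ m) a" for a m by (induction m) auto
  moreover have "total_recursive k (\<lambda>xs. rec_nat (g xs) (\<lambda>i r. h r) (n xs))"
    using assms by (intro total_recursive_rec_nat h recursive_intros) auto
  ultimately show ?thesis by simp
qed

section \<open>Coding space-time diagrams\<close>

lemma digits_exist:
  fixes B :: nat
  assumes "\<And>k. k < N \<Longrightarrow> h k < B"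
  shows "\<exists>z < B ^ N. \<forall>k<N. z div B ^ k mod B = h k"
  using assms
proof (induction N)
  case (Suc N)
  then obtain z where z: "z < B ^ N" "\<forall>k<N. z div B ^ k mod B = h k" by auto
  have hN: "h N < B" using Suc.prems by simp
  have "z + h N * B ^ N < Suc (h N) * B ^ N" using z(1) by simp
  also have "\<dots> \<le> B * B ^ N" using hN by (intro mult_right_mono) auto
  finally have "z + h N * B ^ N < B ^ Suc N" by simp
  moreover have "(z + h N * B ^ N) div B ^ k mod B = h k" if "k < Suc N" for k
  proof (cases "k = N")
    case True
    then show ?thesis using z(1) hN by (simp add: div_mult_self1)
  next
    case False
    then have "B ^ N = B ^ k * (B * B ^ (N - Suc k))"
      using that by (simp add: power_add[symmetric] flip: power_Suc)
    then have "z + h N * B ^ N = z + B ^ k * (B * (h N * B ^ (N - Suc k)))" by simp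
    moreover have "B ^ k \<noteq> 0" using hN by simp
    ultimately have "(z + h N * B ^ N) div B ^ k = z div B ^ k + B * (h N * B ^ (N - Suc k))"
      by (simp only: div_mult_self2) simp
    then show ?thesis using z(2) False that by simp
  qed
  ultimately show ?case by blast
qed simp

text \<open>A digit 1 at position \<open>N + t\<close> pushes the number above \<open>t\<close>.
  Thus a code can also serve as a bound for a time.\<close>

lemma large_number_with_digits:
  fixes B :: nat
  assumes "1 < B" "\<And>k. k < N \<Longrightarrow> h k < B"
  shows "\<exists>z \<ge> t. \<forall>k<N. z div B ^ k mod B = h k"
proof -
  define h' where "h' k = (if k < N then h k else 1)" for k
  have "h' k < B" for k using assms by (simp add: h'_def)
  then obtain z where z: "\<forall>k<N + t + 1. z div B ^ k mod B = h' k"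
    using digits_exist[of "N + t + 1" h' B] by blast
  then have "z div B ^ (N + t) mod B = 1" by (simp add: h'_def)
  then have "B ^ (N + t) \<le> z"
    by (metis div_less mod_0 not_le zero_neq_one)
  moreover have "N + t < B ^ (N + t)" using assms(1) by (intro power_gt_expt) simp
  ultimately show ?thesis using z by (intro exI[of _ z]) (auto simp: h'_def)
qed

locale coded_ca =
  fixes f :: "(int \<Rightarrow> 'a::finite) \<Rightarrow> (int \<Rightarrow> 'a)" and R :: nat and e :: "'a \<Rightarrow> nat" and b :: nat
  assumes commute: "f (translate k x) = translate k (f x)"
    and radius: "has_radius (int R) f"
    and bij_e: "bij_betw e UNIV {..<b}"
    and card: "b = CARD('a)"
begin

text \<open>The base exceeds the size of the alphabet by one, so that numbers with prescribed leading
  digits exist even over a one-letter alphabet.\<close>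

abbreviation base :: nat where "base \<equiv> Suc b"

definition decode :: "nat \<Rightarrow> 'a" where "decode = inv e"

text \<open>The last \<open>mod b\<close> reads the surplus digit \<open>b\<close> as 0, so every
  number has a valid letter at every position.\<close>

definition letter :: "nat \<Rightarrow> nat \<Rightarrow> nat" where
  "letter z i = z div base ^ i mod base mod b"

text \<open>The \<open>2 * R + 1\<close> digits from \<open>i\<close> on, packed into an index for
  the finite table \<open>local_rule\<close>.\<close>

definition block :: "nat \<Rightarrow> nat \<Rightarrow> nat" where
  "block z i = z div base ^ i mod base ^ Suc (2 * R)"

definition local_rule :: "nat \<Rightarrow> nat" where
  "local_rule q = (if q < base ^ Suc (2 * R)
     then e (f (\<lambda>j. decode (letter q (nat (j + int R)))) 0) else 0)"

text \<open>Room for the initial pattern, for the word (whose length is at most its code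
  \<open>c\<close>), and for a margin of \<open>R\<close> per side and time step.\<close>

definition width :: "nat \<Rightarrow> nat \<Rightarrow> nat \<Rightarrow> nat" where
  "width t y c = 2 * y + 2 + c + 2 * R * t"

text \<open>Undoes one recursive clause of \<open>word_code\<close>; truncated subtraction makes 0,
  the code of the empty word, a fixed point.\<close>

definition drop_letter :: "nat \<Rightarrow> nat" where
  "drop_letter c = (c - 1) div b"

text \<open>The digits of \<open>z\<close> are the rows, of length \<open>width t y c\<close>, of a space-time diagram with \<open>t\<close>
  steps. Position \<open>i\<close> of row \<open>\<tau>\<close> is cell \<open>i - (R * t + y + 1) + R * \<tau>\<close>: shifting each row by \<open>R\<close>
  makes the local rule one-sided.\<close>

definition diagram :: "nat \<Rightarrow> nat \<Rightarrow> nat \<Rightarrow> nat \<Rightarrow> bool" where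
  "diagram t z y c \<longleftrightarrow> y \<le> t \<and>
     (\<forall>\<tau><t. \<forall>i<width t y c. i + 2 * R < width t y c \<longrightarrow>
        letter z (Suc \<tau> * width t y c + i) = local_rule (block z (\<tau> * width t y c + i))) \<and>
     (\<forall>i<Suc y. letter z (R * t + y + 1 + i) = letter y (2 * i) \<and>
        letter z (R * t + y - i) = letter y (2 * i + 1)) \<and>
     (\<forall>i<c. (drop_letter ^^ i) c \<noteq> 0 \<longrightarrow>
        letter z (t * width t y c + (y + 1 + i)) = ((drop_letter ^^ i) c - 1) mod b)"

text \<open>\<open>y\<close> codes a cylinder by itself: its size gives the extent, its even and odd
  digits the contents to the right and to the left.\<close>

definition initial :: "nat \<Rightarrow> (int \<Rightarrow> 'a) \<Rightarrow> bool" where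
  "initial y x \<longleftrightarrow> (\<forall>i\<le>y. x (int i) = decode (letter y (2 * i)) \<and>
     x (- 1 - int i) = decode (letter y (2 * i + 1)))"

lemma decode_e [simp]: "decode (e a) = a"
  using bij_e by (simp add: decode_def bij_betw_def)

lemma e_less [simp]: "e a < b"
  using bij_e by (auto simp: bij_betw_def)

lemma e_decode: "n < b \<Longrightarrow> e (decode n) = n"
  using bij_e by (auto simp: decode_def bij_betw_def intro!: f_inv_into_f)

lemma b_pos [simp]: "0 < b"
  by (simp add: card)

lemma letter_less [simp]: "letter z i < b"
  by (simp add: letter_def)

lemma letter_block:
  assumes "j \<le> 2 * R"
  shows "letter (block z i) j = letter z (i + j)"
proof -
  have "base ^ Suc (2 * R) = base ^ j * (base * base ^ (2 * R - j))"
    using assms by (simp add: power_add[symmetric] flip: power_Suc)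
  then have "block z i div base ^ j = z div base ^ i div base ^ j mod (base * base ^ (2 * R - j))"
    unfolding block_def by (simp only: mod_mult2_eq) simp
  then have "block z i div base ^ j mod base = z div base ^ (i + j) mod base"
    by (simp only: power_add div_mult2_eq mod_mult_self2 mod_mod_cancel dvd_triv_left)
  then show ?thesis by (simp add: letter_def)
qed

lemma local_rule_block:
  assumes "\<And>j. j \<le> 2 * R \<Longrightarrow> decode (letter z (k + j)) = x (i - int R + int j)"
  shows "local_rule (block z k) = e (f x i)"
proof -
  have "f (\<lambda>j. decode (letter (block z k) (nat (j + int R)))) 0 = f (translate i x) 0"
  proof (rule has_radiusD[OF radius])
    fix j assume "\<bar>j - 0\<bar> \<le> int R"
    then have j: "nat (j + int R) \<le> 2 * R" "int (nat (j + int R)) = j + int R" by auto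
    show "decode (letter (block z k) (nat (j + int R))) = translate i x j"
      using assms[OF j(1)] letter_block[OF j(1)] j(2) by (simp add: algebra_simps)
  qed
  moreover have "block z k < base ^ Suc (2 * R)" by (simp add: block_def)
  ultimately show ?thesis by (simp add: local_rule_def commute)
qed

lemma word_code_drop_letter:
  "(drop_letter ^^ i) (word_code e w) = word_code e (drop i w)"
proof (induction i arbitrary: w)
  case (Suc i)
  have "drop_letter (word_code e w) = word_code e (tl w)"
    by (cases w) (simp_all add: drop_letter_def div_add1_eq flip: card)
  then show ?case
    using Suc[of "tl w"] by (simp add: funpow_swap1 drop_Suc)
qed simp

lemma word_code_eq_0_iff [simp]: "word_code e w = 0 \<longleftrightarrow> w = []"
  by (cases w) auto

lemma length_le_word_code: "length w \<le> word_code e w"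
proof (induction w)
  case (Cons a w)
  have "word_code e w \<le> CARD('a) * word_code e w" by simp
  with Cons show ?case by (simp only: word_code.simps length_Cons)
qed simp

lemma first_letter_word_code: "w \<noteq> [] \<Longrightarrow> (word_code e w - 1) mod b = e (hd w)"
  by (cases w) (auto simp: card[symmetric])

text \<open>Row 0 is read as a configuration. By induction the later rows show its iterates, on a
  stretch that loses \<open>2 * R\<close> positions per step.\<close>

lemma diagram_sound:
  assumes diag: "diagram t z y (word_code e w)"
  shows "\<exists>x. initial y x \<and> (f ^^ t) x \<in> cylinder w"
proof -
  define W where "W = width t y (word_code e w)"
  define A where "A = R * t + y + 1"
  \<comment> \<open>To the right of row 0 further digits of \<open>z\<close> are used, to its left
    digit 0, so the claim for row 0 holds at every position.\<close>
  define x where "x i = decode (letter z (nat (i + int A)))" for i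
  have step: "letter z (Suc \<tau> * W + i) = local_rule (block z (\<tau> * W + i))"
    if "\<tau> < t" "i + 2 * R < W" for \<tau> i
    using diag that by (simp add: diagram_def W_def)
  have init: "letter z (A + i) = letter y (2 * i)" "letter z (A - 1 - i) = letter y (2 * i + 1)"
    if "i \<le> y" for i
    using diag that by (auto simp: diagram_def A_def)
  have final: "letter z (t * W + (y + 1 + i)) = e (w ! i)" if "i < length w" for i
  proof -
    have "i < word_code e w" using that length_le_word_code[of w] by simp
    then have "letter z (t * W + (y + 1 + i)) = (word_code e (drop i w) - 1) mod b"
      using diag that by (simp add: diagram_def W_def word_code_drop_letter)
    then show ?thesis
      using first_letter_word_code[of "drop i w"] that by (simp add: hd_drop_conv_nth)
  qed
  have rows: "decode (letter z (\<tau> * W + i)) = (f ^^ \<tau>) x (int i - int A + int (R * \<tau>))"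
    if "\<tau> \<le> t" "\<tau> = 0 \<or> i + 2 * R * \<tau> < W" for \<tau> i
    using that
  proof (induction \<tau> arbitrary: i)
    case 0
    then show ?case by (simp add: x_def)
  next
    case (Suc \<tau>)
    have "local_rule (block z (\<tau> * W + i)) = e (f ((f ^^ \<tau>) x) (int i - int A + int (R * Suc \<tau>)))"
    proof (rule local_rule_block)
      fix j assume j: "j \<le> 2 * R"
      have "decode (letter z (\<tau> * W + (i + j))) = (f ^^ \<tau>) x (int (i + j) - int A + int (R * \<tau>))"
        using Suc.prems j by (intro Suc.IH) (auto simp: algebra_simps)
      then show "decode (letter z (\<tau> * W + i + j)) =
          (f ^^ \<tau>) x (int i - int A + int (R * Suc \<tau>) - int R + int j)"
        by (simp add: algebra_simps)
    qed
    then show ?case using step[of \<tau> i] Suc.prems by simp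
  qed
  have "initial y x"
    unfolding initial_def
  proof (intro allI impI)
    fix i assume i: "i \<le> y"
    have "nat (int i + int A) = A + i" "nat (- 1 - int i + int A) = A - 1 - i"
      using i by (auto simp: A_def nat_add_distrib nat_diff_distrib nat_mult_distrib simp flip: of_nat_mult of_nat_add)
    then show "x (int i) = decode (letter y (2 * i)) \<and> x (- 1 - int i) = decode (letter y (2 * i + 1))"
      using init[OF i] by (simp add: x_def)
  qed
  moreover have "(f ^^ t) x \<in> cylinder w"
    unfolding cylinder_def
  proof (intro CollectI allI impI)
    fix i assume i: "i < length w"
    have "decode (letter z (t * W + (y + 1 + i))) = (f ^^ t) x (int (y + 1 + i) - int A + int (R * t))"
      using i length_le_word_code[of w] by (intro rows) (auto simp: W_def width_def)
    then show "(f ^^ t) x (int i) = w ! i"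
      using final[OF i] by (simp add: A_def)
  qed
  ultimately show ?thesis by blast
qed

text \<open>The digits of \<open>z\<close> spell out the true space-time diagram of
  \<open>x\<close>, digit \<open>k\<close> in row \<open>k div W\<close>. Choosing \<open>z\<close>
  at least \<open>t\<close> lets the search for \<open>z\<close> bound the time.\<close>

lemma diagram_complete:
  assumes "y \<le> t" and init: "initial y x" and cyl: "(f ^^ t) x \<in> cylinder w"
  shows "\<exists>z\<ge>t. diagram t z y (word_code e w)"
proof -
  define W where "W = width t y (word_code e w)"
  define A where "A = R * t + y + 1"
  have W_pos: "0 < W" and A_W: "A + y < W" by (simp_all add: W_def width_def A_def)
  define h where "h k = e ((f ^^ (k div W)) x (int (k mod W) - int A + int (R * (k div W))))" for k
  have "h k < base" for k
    using e_less less_Suc_eq unfolding h_def by blast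
  then obtain z where z: "t \<le> z" "\<forall>k<Suc t * W. z div base ^ k mod base = h k"
    using large_number_with_digits[of base "Suc t * W" h t] b_pos by auto
  have row: "letter z (\<tau> * W + i) = e ((f ^^ \<tau>) x (int i - int A + int (R * \<tau>)))"
    if "\<tau> \<le> t" "i < W" for \<tau> i
  proof -
    have "\<tau> * W + i < Suc \<tau> * W" using that by simp
    also have "\<dots> \<le> Suc t * W" using that by (intro mult_right_mono) auto
    finally have "letter z (\<tau> * W + i) = h (\<tau> * W + i) mod b" using z(2) by (simp add: letter_def)
    moreover have "(\<tau> * W + i) div W = \<tau>" "(\<tau> * W + i) mod W = i" using that by auto
    ultimately show ?thesis by (simp add: h_def)
  qed
  have "letter z (Suc \<tau> * W + i) = local_rule (block z (\<tau> * W + i))"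
    if "\<tau> < t" "i + 2 * R < W" for \<tau> i
  proof -
    have "local_rule (block z (\<tau> * W + i)) = e (f ((f ^^ \<tau>) x) (int i - int A + int (R * Suc \<tau>)))"
    proof (rule local_rule_block)
      fix j assume j: "j \<le> 2 * R"
      have "letter z (\<tau> * W + (i + j)) = e ((f ^^ \<tau>) x (int (i + j) - int A + int (R * \<tau>)))"
        using that j by (intro row) auto
      then show "decode (letter z (\<tau> * W + i + j)) =
          (f ^^ \<tau>) x (int i - int A + int (R * Suc \<tau>) - int R + int j)"
        by (simp add: algebra_simps)
    qed
    then show ?thesis using row[of "Suc \<tau>" i] that by simp
  qed
  moreover have "letter z (R * t + y + 1 + i) = letter y (2 * i) \<and>
      letter z (R * t + y - i) = letter y (2 * i + 1)" if "i < Suc y" for i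
  proof -
    have "letter z (A + i) = e (x (int i))"
      using row[of 0 "A + i"] A_W that by simp
    moreover have "letter z (A - 1 - i) = e (x (- 1 - int i))"
      using row[of 0 "A - 1 - i"] A_W that by (simp add: A_def of_nat_diff)
    ultimately show ?thesis
      using init that by (simp add: initial_def A_def e_decode)
  qed
  moreover have "letter z (t * W + (y + 1 + i)) = ((drop_letter ^^ i) (word_code e w) - 1) mod b"
    if "(drop_letter ^^ i) (word_code e w) \<noteq> 0" for i
  proof -
    have i: "i < length w" using that by (simp add: word_code_drop_letter)
    then have "letter z (t * W + (y + 1 + i)) = e ((f ^^ t) x (int i))"
      using row[of t "y + 1 + i"] length_le_word_code[of w] by (simp add: W_def width_def A_def)
    also have "\<dots> = e (w ! i)" using cyl i by (simp add: cylinder_def)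
    finally show ?thesis
      using first_letter_word_code[of "drop i w"] i
      by (simp add: word_code_drop_letter hd_drop_conv_nth)
  qed
  ultimately show ?thesis
    using z(1) \<open>y \<le> t\<close> by (intro exI[of _ z]) (simp add: diagram_def W_def)
qed

lemma ex_initial_subset_window:
  "\<exists>y\<ge>T. {x. initial y x} \<subseteq> window p m"
proof -
  define N where "N = nat \<bar>m\<bar>"
  define h where "h k = e (if even k then p (int (k div 2)) else p (- 1 - int (k div 2)))" for k
  have "h k < base" for k
    using e_less less_Suc_eq unfolding h_def by blast
  then obtain y where y: "max N T \<le> y" "\<forall>k<2 * N + 2. y div base ^ k mod base = h k"
    using large_number_with_digits[of base "2 * N + 2" h "max N T"] b_pos by auto
  have letters: "letter y k = h k" if "k < 2 * N + 2" for k
    using y(2) that by (simp add: letter_def h_def)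
  have "x \<in> window p m" if x: "initial y x" for x
    unfolding window_def
  proof (intro CollectI allI impI)
    fix i assume i: "\<bar>i\<bar> \<le> m"
    show "x i = p i"
    proof (cases "0 \<le> i")
      case True
      define k where "k = nat i"
      then have k: "i = int k" "k \<le> N" using True i by (auto simp: N_def)
      then have "x i = decode (letter y (2 * k))" using x y(1) by (simp add: initial_def)
      then show ?thesis using letters[of "2 * k"] k by (simp add: h_def)
    next
      case False
      define k where "k = nat (- 1 - i)"
      then have k: "i = - 1 - int k" "k \<le> N" using False i by (auto simp: N_def)
      then have "x i = decode (letter y (2 * k + 1))" using x y(1) by (simp add: initial_def)
      then show ?thesis using letters[of "2 * k + 1"] k by (simp add: h_def)
    qed
  qed
  then show ?thesis using y(1) by (intro exI[of _ y]) auto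
qed

lemma ex_window_subset_initial: "\<exists>p. window p (int y + 1) \<subseteq> {x. initial y x}"
proof -
  define p where "p i = decode (letter y (if 0 \<le> i then 2 * nat i else 2 * nat (- 1 - i) + 1))" for i
  have "window p (int y + 1) \<subseteq> {x. initial y x}"
    by (auto simp: window_def initial_def p_def)
  then show ?thesis by blast
qed

text \<open>\<open>y\<close> stands for both the window and the time bound, since
  \<open>diagram\<close> demands \<open>y \<le> t\<close>; \<open>z\<close> stands for both the
  diagram and the time, which is at most \<open>z\<close>.\<close>

lemma recurrent_iff_diagram:
  "(\<forall>p m T. \<exists>t\<ge>T. \<exists>x\<in>window p m. (f ^^ t) x \<in> cylinder w) \<longleftrightarrow>
   (\<forall>y. \<exists>z. \<exists>t<Suc z. diagram t z y (word_code e w))"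
proof
  assume rec: "\<forall>p m T. \<exists>t\<ge>T. \<exists>x\<in>window p m. (f ^^ t) x \<in> cylinder w"
  show "\<forall>y. \<exists>z. \<exists>t<Suc z. diagram t z y (word_code e w)"
  proof
    fix y
    obtain p where p: "window p (int y + 1) \<subseteq> {x. initial y x}"
      using ex_window_subset_initial by blast
    obtain t x where "y \<le> t" "x \<in> window p (int y + 1)" "(f ^^ t) x \<in> cylinder w"
      using rec by blast
    then show "\<exists>z. \<exists>t<Suc z. diagram t z y (word_code e w)"
      using diagram_complete[of y t x w] p by (auto simp: less_Suc_eq_le)
  qed
next
  assume diag: "\<forall>y. \<exists>z. \<exists>t<Suc z. diagram t z y (word_code e w)"
  show "\<forall>p m T. \<exists>t\<ge>T. \<exists>x\<in>window p m. (f ^^ t) x \<in> cylinder w"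
  proof (intro allI)
    fix p m T
    obtain y where y: "T \<le> y" "{x. initial y x} \<subseteq> window p m"
      using ex_initial_subset_window by blast
    obtain z t where d: "diagram t z y (word_code e w)" using diag by blast
    then obtain x where "initial y x" "(f ^^ t) x \<in> cylinder w"
      using diagram_sound by blast
    moreover have "y \<le> t" using d by (simp add: diagram_def)
    ultimately show "\<exists>t\<ge>T. \<exists>x\<in>window p m. (f ^^ t) x \<in> cylinder w"
      using y by (intro exI[of _ t]) auto
  qed
qed

lemma decidable_diagram:
  "decidable_rel 3 (\<lambda>xs. \<exists>t<Suc (xs ! 0). diagram t (xs ! 0) (xs ! 1) (xs ! 2))"
proof -
  have letter: "total_recursive k (\<lambda>xs. letter (g xs) (h xs))"
    if "total_recursive k g" "total_recursive k h" for k g h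
    unfolding letter_def using that by (intro recursive_intros)
  have block: "total_recursive k (\<lambda>xs. block (g xs) (h xs))"
    if "total_recursive k g" "total_recursive k h" for k g h
    unfolding block_def using that by (intro recursive_intros)
  have rule: "total_recursive k (\<lambda>xs. local_rule (g xs))"
    if "total_recursive k g" for k g
    unfolding local_rule_def
    using total_recursive_table[OF that, of "base ^ Suc (2 * R)"
        "\<lambda>q. e (f (\<lambda>j. decode (letter q (nat (j + int R)))) 0)"] .
  have iter: "total_recursive k (\<lambda>xs. (drop_letter ^^ g xs) (h xs))"
    if "total_recursive k g" "total_recursive k h" for k g h
    using that by (intro total_recursive_funpow) (unfold drop_letter_def, intro recursive_intros)
  show ?thesis
    unfolding diagram_def width_def
    by (intro recursive_intros letter block rule iter) simp_all
qed

end

text \<open>Each quantifier level puts its variable at the head of the list, so the innermost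
  variable \<open>z\<close> comes first.\<close>

lemma Pi0_2I:
  assumes "decidable_rel 3 D" "\<And>c. c \<in> S \<longleftrightarrow> (\<forall>y. \<exists>z. D [z, y, c])"
  shows "Pi0 2 S"
proof -
  have "is_Sigma (Suc 0) 2 (\<lambda>xs. \<exists>z. D (z # xs))"
    using assms(1) by (auto simp: numeral_3_eq_3 numeral_2_eq_2)
  moreover have "xs ! 0 \<in> S \<longleftrightarrow> (\<forall>y. \<exists>z. D (z # y # xs))" if "length xs = 1" for xs
    using assms(2)[of "xs ! 0"] that by (auto simp: length_Suc_conv)
  ultimately show ?thesis
    unfolding Pi0_def by (auto simp: numeral_2_eq_2)
qed

theorem proposition4:
  fixes f :: "(int \<Rightarrow> 'a::finite) \<Rightarrow> (int \<Rightarrow> 'a)"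
  assumes "cellular_automaton UNIV f"
    and "eventually_oblique (generic_limit_set f) f"
  shows "Pi0_words 2 (language (generic_limit_set f))"
  unfolding Pi0_words_def
proof (intro allI impI)
  fix e :: "'a \<Rightarrow> nat" assume e: "bij_betw e UNIV {..<CARD('a)}"
  obtain R where R: "0 \<le> R" "has_radius R f"
    using cellular_automaton_radius[OF assms(1)] .
  interpret coded_ca f "nat R" e "CARD('a)"
  proof
    show "f (translate k x) = translate k (f x)" for k x
      using assms(1) by (intro commute_translate) (simp add: cellular_automaton_def)
  qed (use R e in auto)
  show "Pi0 2 (word_code e ` language (generic_limit_set f))"
  proof (rule Pi0_2I[OF decidable_diagram])
    fix c
    obtain w where w: "c = word_code e w"
      using bij_word_code[OF e] by (meson bij_pointE)
    have "c \<in> word_code e ` language (generic_limit_set f) \<longleftrightarrow> w \<in> language (generic_limit_set f)"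
      using w bij_word_code[OF e] by (simp add: bij_is_inj inj_image_mem_iff)
    also have "\<dots> \<longleftrightarrow> (\<forall>y. \<exists>z. \<exists>t<Suc z. diagram t z y (word_code e w))"
      by (simp only: language_generic_limit_set_iff[OF assms] recurrent_iff_diagram)
    finally show "c \<in> word_code e ` language (generic_limit_set f) \<longleftrightarrow>
        (\<forall>y. \<exists>z. \<exists>t<Suc ([z, y, c] ! 0). diagram t ([z, y, c] ! 0) ([z, y, c] ! 1) ([z, y, c] ! 2))"
      by (simp add: w)
  qed
qed

end
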